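(* Let $t>0$. (1) There are constants $C_0\in\mathbb R$ and $\varepsilon_0>0$, independent of the matrix $A=A^*\le0$ and the vector $b\ne0$, such that $\|e^{tA}b-u_m^{\rm SI}\|_2\le\varepsilon\|b\|_2$ for $0<\varepsilon<\varepsilon_0$ whenever $$m\ge\left\lceil\frac{L_\varepsilon-\frac12\log L_\varepsilon}{\operatorname{arsinh}(1)}+C_0\right\rceil,\qquad q=\frac m{\sqrt2\,t},\qquad L_\varepsilon=\log(1/\varepsilon),$$ where $u_m^{\rm SI}$ is the degree-$m$ shift-and-invert approximation with pole $q$. (2) Alternatively, let $q_N=\widehat\alpha N/t$ be fixed before iteration ($\widehat\alpha>0$) and let the realized degrees $m_N$ satisfy $m_N/N\to\vartheta>0$, with $0<\widehat\alpha/\vartheta<\alpha_c=\frac{3\sqrt3}2$. For any sequence of matrices $A_N=A_N^*\le0$ and vectors $b_N\neq 0$ of arbitrary dimensions, $$\limsup_{N\to\infty}\left(\frac{\|e^{tA_N}b_N-u_{m_N,N}^{\rm SI}\|_2}{\|b_N\|_2}\right)^{1/m_N}\le H_e(\widehat\alpha/\vartheta),$$ where $u_{m_N,N}^{\rm SI}$ is the degree-$m_N$ shift-and-invert approximation for $(A_N,b_N)$ with pole $q_N$. In particular, if $\widehat\alpha=\alpha_*=1/\sqrt2$ and $m_N=N+o(N)$, the bound is $\sqrt2-1$; and if $\widehat\alpha=\alpha_*$ and $m_N/N\to1+\epsilon$ with $|\epsilon|$ sufficiently small, the bound is $H_e(\alpha_*/(1+\epsilon))$, with $\log H_e(\alpha_*/(1+\epsilon))=\log(\sqrt2-1)+\frac{\epsilon^2}{5\sqrt2}+O(\epsilon^3)$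 as $\epsilon\to0$.
   Context: $A=A^*\le0$ means a complex Hermitian negative semidefinite matrix. For $q>0$ and an integer $m\ge0$ the repeated shift-and-invert space is $$\mathcal Q_{m+1}(A,b;q)=\operatorname{span}\{b,(qI-A)^{-1}b,\dots,(qI-A)^{-m}b\}.$$ Let $V_{m+1}$ be a matrix whose columns form an orthonormal basis of this space (which may have dimension less than $m+1$), $A_{m+1}=V_{m+1}^*AV_{m+1}$; the degree-$m$ shift-and-invert approximation with pole $q$ is $$u_m^{\rm SI}=V_{m+1}\exp(tA_{m+1})V_{m+1}^*b .$$ (If the space becomes invariant at an earlier degree, the approximation is exact and remains so at later degrees.) For $0<\alpha<\alpha_c$, $\zeta_\alpha$ is the unique root of $\alpha(\zeta^3-\zeta)+1=0$ in the open first quadrant, and $H_e(\alpha)=\left|\frac{\zeta_\alpha-1}{\zeta_\alpha+1}\right|\exp\bigl(\alpha\operatorname{Re}(\zeta_\alpha^2)\bigr)$. Note $\operatorname{arsinh}(1)=\log(1+\sqrt2)$. *)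

theory Defs
  imports
    "HOL-Analysis.Analysis"
    "HOL-Library.Landau_Symbols"
    "Jordan_Normal_Form.Matrix"
    "Jordan_Normal_Form.Gauss_Jordan_Elimination"
    "Jordan_Normal_Form.Schur_Decomposition"
    "Jordan_Normal_Form.VS_Connect"
begin

text \<open>Dimensions vary along sequences, so matrices and vectors are the dynamically sized ones of
  Jordan-Normal-Form, with explicit carriers.\<close>

definition vec_norm2 :: "complex Matrix.vec \<Rightarrow> real" where
  "vec_norm2 v = L2_set (\<lambda>i. cmod (vec_index v i)) {..<dim_vec v}"

definition mat_exp :: "complex mat \<Rightarrow> complex mat" where
  "mat_exp A = Matrix.mat (dim_row A) (dim_row A) (\<lambda>ij. \<Sum>k. (A ^\<^sub>m k) $$ ij / fact k)"

text \<open>The quadratic form below is \<open>v\<^sup>* A v\<close>, since \<open>x \<bullet>c v\<close> conjugates its second argument.\<close>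

definition hermitian_nsd :: "nat \<Rightarrow> complex mat \<Rightarrow> bool" where
  "hermitian_nsd n A \<longleftrightarrow> A \<in> carrier_mat n n \<and> mat_adjoint A = A \<and>
     (\<forall>v \<in> carrier_vec n. Re ((A *\<^sub>v v) \<bullet>c v) \<le> 0)"

definition cspan :: "nat \<Rightarrow> complex Matrix.vec set \<Rightarrow> complex Matrix.vec set" where
  "cspan n S = LinearCombinations.module.span class_ring (module_vec TYPE(complex) n) S"

text \<open>\<open>mat_inverse\<close> returns an option; for \<open>q > 0\<close> and negative semidefinite \<open>A\<close> the matrix
  \<open>q I - A\<close> is invertible, so the selector \<open>the\<close> is harmless.\<close>

definition shift_inverse :: "complex mat \<Rightarrow> real \<Rightarrow> complex mat" where
  "shift_inverse A q = the (mat_inverse (complex_of_real q \<cdot>\<^sub>m 1\<^sub>m (dim_row A) - A))"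

text \<open>\<open>si_space A b q m\<close> is \<open>\<Q>\<^bsub>m+1\<^esub>(A, b; q)\<close>, indexed by the degree \<open>m\<close>.\<close>

definition si_space :: "complex mat \<Rightarrow> complex Matrix.vec \<Rightarrow> real \<Rightarrow> nat \<Rightarrow> complex Matrix.vec set" where
  "si_space A b q m = cspan (dim_row A) {(shift_inverse A q ^\<^sub>m j) *\<^sub>v b | j. j \<le> m}"

text \<open>The number of columns is not prescribed: the space may have dimension less than \<open>m + 1\<close>.\<close>

definition si_basis :: "complex mat \<Rightarrow> complex Matrix.vec \<Rightarrow> real \<Rightarrow> nat \<Rightarrow> complex mat \<Rightarrow> bool" where
  "si_basis A b q m V \<longleftrightarrow> dim_row V = dim_row A \<and>
     mat_adjoint V * V = 1\<^sub>m (dim_col V) \<and>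
     cspan (dim_row A) (set (cols V)) = si_space A b q m"

definition si_approx :: "real \<Rightarrow> complex mat \<Rightarrow> complex Matrix.vec \<Rightarrow> complex mat \<Rightarrow> complex Matrix.vec" where
  "si_approx t A b V =
     V *\<^sub>v (mat_exp (complex_of_real t \<cdot>\<^sub>m (mat_adjoint V * A * V)) *\<^sub>v (mat_adjoint V *\<^sub>v b))"

definition si_error :: "real \<Rightarrow> complex mat \<Rightarrow> complex Matrix.vec \<Rightarrow> complex mat \<Rightarrow> real" where
  "si_error t A b V =
     vec_norm2 (mat_exp (complex_of_real t \<cdot>\<^sub>m A) *\<^sub>v b - si_approx t A b V)"

text \<open>A sequence of problems of arbitrary dimensions \<open>n N\<close>, together with orthonormal bases \<open>V N\<close>
  of the degree-\<open>m N\<close> spaces with pole \<open>a N / t\<close>. Indices start at 1 because the pole must be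
  positive.\<close>

definition si_sequence ::
  "real \<Rightarrow> real \<Rightarrow> (nat \<Rightarrow> nat) \<Rightarrow> (nat \<Rightarrow> nat) \<Rightarrow> (nat \<Rightarrow> complex mat) \<Rightarrow>
   (nat \<Rightarrow> complex Matrix.vec) \<Rightarrow> (nat \<Rightarrow> complex mat) \<Rightarrow> bool" where
  "si_sequence t a m n A b V \<longleftrightarrow>
     (\<forall>N\<ge>1. hermitian_nsd (n N) (A N) \<and> b N \<in> carrier_vec (n N) \<and> b N \<noteq> 0\<^sub>v (n N) \<and>
            si_basis (A N) (b N) (a * real N / t) (m N) (V N))"

definition si_root_limsup ::
  "real \<Rightarrow> (nat \<Rightarrow> nat) \<Rightarrow> (nat \<Rightarrow> complex mat) \<Rightarrow> (nat \<Rightarrow> complex Matrix.vec) \<Rightarrow>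
   (nat \<Rightarrow> complex mat) \<Rightarrow> ereal" where
  "si_root_limsup t m A b V =
     limsup (\<lambda>N. ereal ((si_error t (A N) (b N) (V N) / vec_norm2 (b N)) powr (1 / real (m N))))"

definition alpha_c :: real where
  "alpha_c = 3 * sqrt 3 / 2"

definition alpha_star :: real where
  "alpha_star = 1 / sqrt 2"

text \<open>Meaningful for \<open>0 < \<alpha> < alpha_c\<close> only, where the root exists and is unique.\<close>

definition zeta_root :: "real \<Rightarrow> complex" where
  "zeta_root \<alpha> = (THE z. Re z > 0 \<and> Im z > 0 \<and> complex_of_real \<alpha> * (z ^ 3 - z) + 1 = 0)"

definition H_e :: "real \<Rightarrow> real" where
  "H_e \<alpha> = cmod ((zeta_root \<alpha> - 1) / (zeta_root \<alpha> + 1)) * exp (\<alpha> * Re ((zeta_root \<alpha>)\<^sup>2))"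

end

theory Submission
  imports Defs
    "Jordan_Normal_Form.Spectral_Radius"
    "HOL-Complex_Analysis.Complex_Analysis"
    "HOL-Real_Asymp.Real_Asymp"
begin

text \<open>
The whole statement follows from one bound that holds for every degree \<open>m \<ge> 1\<close>
(\<open>si_error_bound\<close>): the error is at most \<open>C m\<^sup>-\<^sup>1\<^sup>/\<^sup>2 H\<^sup>m \<parallel>b\<parallel>\<close>, where \<open>H = H_e \<alpha>\<close> with
\<open>\<alpha> = t q / m < alpha_c\<close>, and \<open>C\<close> depends continuously on \<open>\<alpha>\<close> alone.

\<^bold>\<open>From matrices to scalars.\<close> The compression of \<open>A\<close> to the shift-and-invert space reproduces
\<open>p((qI - A)\<^sup>-\<^sup>1) b\<close> exactly for every polynomial \<open>p\<close> of degree at most \<open>m\<close>, and it is again Hermitian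
and negative semidefinite. By the spectral theorem the error is therefore at most twice the
distance, uniformly over the two spectra, between \<open>exp (t x)\<close> and any \<open>p(1 / (q - x))\<close>
(\<open>si_error_quasi_optimal\<close>).

\<^bold>\<open>Rational approximation of the exponential.\<close> Put \<open>x = - q v\<^sup>2\<close> and \<open>\<beta> = t q\<close>, so that the
exponential becomes the Gaussian \<open>exp (- \<beta> v\<^sup>2)\<close>. Let \<open>w(u) = (i - u) / (i + u)\<close> be the Cayley transform.
For real \<open>v\<close> the number \<open>y = w(v)\<close> lies on the unit circle and \<open>y + 1/y\<close> is affine in \<open>1 / (q - x)\<close>,
so \<open>y\<^sup>k + y\<^sup>-\<^sup>k\<close> is an admissible polynomial of degree \<open>k\<close>. Cauchy's formula on a strip writes the
Gaussian as an integral over the line \<open>Im u = c\<close> against the kernel \<open>1/(u - v) + 1/(u + v)\<close>. Apart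
from the term \<open>2 / (u + i)\<close> and a factor \<open>2 i / (u + i)\<^sup>2\<close>, the kernel is a power series in \<open>w(u)\<close> whose
coefficients are such polynomials in \<open>1 / (q - x)\<close>; cutting it after \<open>m\<close> terms leaves a remainder of size at most
\<open>2 |w(u)|\<^sup>m / c\<close>, uniformly in \<open>v\<close>. The approximation error is thus controlled by the integral of
\<open>|exp (- \<beta> u\<^sup>2) w(u)\<^sup>m|\<close> along the line (\<open>rational_approximation\<close>).

\<^bold>\<open>The saddle points.\<close> With \<open>\<beta> = \<alpha> m\<close> the integrand is an \<open>m\<close>-th power, and its base has critical
points exactly where \<open>\<alpha> (\<zeta>\<^sup>3 - \<zeta>) + 1 = 0\<close> (after \<open>u = i \<zeta>\<close>). Everything becomes explicit in terms of the
number \<open>r > 0\<close> for which \<open>- r\<close> is the real root of this cubic: \<open>\<alpha> = 1 / (r (r\<^sup>2 - 1))\<close> and the other roots have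
real part \<open>r / 2\<close>. On the line \<open>c = r / 2\<close> the base is largest at the two saddles, where it equals \<open>H_e \<alpha>\<close>,
and it decays like a Gaussian away from them; this yields the factor \<open>m\<^sup>-\<^sup>1\<^sup>/\<^sup>2\<close>.

\<^bold>\<open>Conclusions.\<close> For \<open>\<alpha> = 1 / sqrt 2\<close> one has \<open>r = sqrt 2\<close> and \<open>H = sqrt 2 - 1 = exp (- arsinh 1)\<close>; solving
\<open>C m\<^sup>-\<^sup>1\<^sup>/\<^sup>2 H\<^sup>m \<le> \<epsilon>\<close> for \<open>m\<close> gives the degree rule, the square root being responsible for its
\<open>log L\<^sub>\<epsilon> / 2\<close> term. The root limit follows because \<open>r\<close> is a Lipschitz function of \<open>1/\<alpha>\<close>, and the expansion of
\<open>log H_e\<close> is Taylor's formula in the variable \<open>r\<close>.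
\<close>

section \<open>Adjoints and the Euclidean norm\<close>

lemma mat_adjoint_dim [simp]:
  "dim_row (mat_adjoint A) = dim_col A" "dim_col (mat_adjoint A) = dim_row A"
  by (simp_all add: mat_adjoint_def)

lemma mat_adjoint_index [simp]:
  fixes A :: "complex mat"
  assumes "i < dim_col A" "j < dim_row A"
  shows "mat_adjoint A $$ (i, j) = cnj (A $$ (j, i))"
  using assms by (simp add: mat_adjoint_def mat_of_rows_index)

lemma mat_adjoint_carrier [simp]:
  "A \<in> carrier_mat m n \<Longrightarrow> mat_adjoint A \<in> carrier_mat n m"
  by (intro carrier_matI) auto

lemma mat_adjoint_adjoint [simp]: "mat_adjoint (mat_adjoint A) = (A :: complex mat)"
  by (rule eq_matI) auto

lemma mat_adjoint_mult:
  fixes A B :: "complex mat"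
  assumes "A \<in> carrier_mat m k" "B \<in> carrier_mat k n"
  shows "mat_adjoint (A * B) = mat_adjoint B * mat_adjoint A"
  using assms by (intro eq_matI) (auto simp: scalar_prod_def mult.commute)

lemma mult_mat_vec_cscalar:
  fixes A :: "complex mat"
  assumes "A \<in> carrier_mat m n" "x \<in> carrier_vec n" "y \<in> carrier_vec m"
  shows "(A *\<^sub>v x) \<bullet>c y = x \<bullet>c (mat_adjoint A *\<^sub>v y)"
proof -
  have "(A *\<^sub>v x) \<bullet>c y = (\<Sum>i<m. \<Sum>j<n. A $$ (i,j) * vec_index x j * cnj (vec_index y i))"
    using assms by (auto simp: scalar_prod_def sum_distrib_right atLeast0LessThan intro!: sum.cong)
  also have "\<dots> = (\<Sum>j<n. \<Sum>i<m. A $$ (i,j) * vec_index x j * cnj (vec_index y i))"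
    by (rule sum.swap)
  also have "\<dots> = x \<bullet>c (mat_adjoint A *\<^sub>v y)"
    using assms by (auto simp: scalar_prod_def sum_distrib_left atLeast0LessThan mult_ac intro!: sum.cong)
  finally show ?thesis .
qed

lemma vec_norm2_nonneg [simp]: "vec_norm2 v \<ge> 0"
  by (simp add: vec_norm2_def L2_set_nonneg)

lemma cscalar_self: "v \<bullet>c v = complex_of_real ((vec_norm2 v)\<^sup>2)"
proof -
  have "v \<bullet>c v = (\<Sum>i<dim_vec v. vec_index v i * cnj (vec_index v i))"
    by (simp add: scalar_prod_def atLeast0LessThan)
  also have "\<dots> = complex_of_real (\<Sum>i<dim_vec v. (cmod (vec_index v i))\<^sup>2)"
    unfolding of_real_sum by (rule sum.cong[OF refl]) (simp only: complex_norm_square[symmetric])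
  also have "(\<Sum>i<dim_vec v. (cmod (vec_index v i))\<^sup>2) = (vec_norm2 v)\<^sup>2"
    unfolding vec_norm2_def L2_set_def by (rule real_sqrt_pow2[symmetric], rule sum_nonneg, rule zero_le_power2)
  finally show ?thesis .
qed

lemma vec_norm2_isometry:
  assumes "U \<in> carrier_mat n k" "mat_adjoint U * U = 1\<^sub>m k" "x \<in> carrier_vec k"
  shows "vec_norm2 (U *\<^sub>v x) = vec_norm2 x"
proof -
  have Ux: "U *\<^sub>v x \<in> carrier_vec n" using assms by simp
  have "(U *\<^sub>v x) \<bullet>c (U *\<^sub>v x) = x \<bullet>c (mat_adjoint U *\<^sub>v (U *\<^sub>v x))"
    by (rule mult_mat_vec_cscalar[OF assms(1,3) Ux])
  also have "mat_adjoint U *\<^sub>v (U *\<^sub>v x) = (mat_adjoint U * U) *\<^sub>v x"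
    by (rule assoc_mult_mat_vec[symmetric, OF mat_adjoint_carrier[OF assms(1)] assms(1,3)])
  also have "\<dots> = x" using assms by simp
  finally have "(vec_norm2 (U *\<^sub>v x))\<^sup>2 = (vec_norm2 x)\<^sup>2"
    unfolding cscalar_self by (simp only: of_real_eq_iff)
  thus ?thesis by (rule power2_eq_imp_eq) (rule vec_norm2_nonneg)+
qed

lemma vec_norm2_pos:
  assumes "v \<in> carrier_vec n" "v \<noteq> 0\<^sub>v n"
  shows "vec_norm2 v > 0"
proof -
  have "v \<bullet>c v \<noteq> 0"
    using conjugate_square_eq_0_vec[OF assms(1)] assms(2) by blast
  hence "vec_norm2 v \<noteq> 0" unfolding cscalar_self by (auto simp only: power_zero_numeral of_real_0)
  thus ?thesis using vec_norm2_nonneg[of v] by (rule le_neq_trans[OF _ not_sym, rotated])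
qed

lemma vec_norm2_triangle:
  assumes "x \<in> carrier_vec n" "y \<in> carrier_vec n"
  shows "vec_norm2 (x + y) \<le> vec_norm2 x + vec_norm2 y"
proof -
  have d: "dim_vec x = n" "dim_vec y = n" "dim_vec (x + y) = n" using assms by auto
  have "vec_norm2 (x + y) \<le> L2_set (\<lambda>i. cmod (vec_index x i) + cmod (vec_index y i)) {..<n}"
    unfolding vec_norm2_def d
  proof (rule L2_set_mono)
    fix i assume "i \<in> {..<n}"
    thus "cmod (vec_index (x + y) i) \<le> cmod (vec_index x i) + cmod (vec_index y i)"
      using d norm_triangle_ineq[of "vec_index x i" "vec_index y i"] by simp
  qed simp
  also have "\<dots> \<le> vec_norm2 x + vec_norm2 y"
    unfolding vec_norm2_def d by (rule L2_set_triangle_ineq)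
  finally show ?thesis .
qed

section \<open>The spectral theorem and its functional calculus\<close>

text \<open>The induction step of the spectral theorem needs an eigenvector as first column of a unitary
  matrix: complete it to a basis, orthogonalise by Gram-Schmidt, and normalise.\<close>

lemma unitary_with_first_column:
  fixes v :: "complex vec"
  assumes v: "v \<in> carrier_vec n" "v \<noteq> 0\<^sub>v n"
  obtains W c where "W \<in> carrier_mat n n" "mat_adjoint W * W = 1\<^sub>m n" "col W 0 = c \<cdot>\<^sub>v v" "n > 0"
proof -
  interpret cof_vec_space n "TYPE(complex)" .
  have n: "n > 0" using v by (cases n) auto
  define b where "b = basis_completion v"
  define ws where "ws = gram_schmidt n b"
  from basis_completion[OF v, folded b_def]
  have dist_b: "distinct b" and indep: "\<not> lin_dep (set b)" and b: "set b \<subseteq> carrier_vec n"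
    and hdb: "hd b = v" and len_b: "length b = n" by auto
  from hdb len_b n obtain vs where bv: "b = v # vs" by (cases b) auto
  from gram_schmidt_result[OF b dist_b indep refl, folded ws_def]
  have ws: "set ws \<subseteq> carrier_vec n" "corthogonal ws" "length ws = n"
    by (auto simp: len_b)
  have hdws: "hd ws = v"
    using gram_schmidt_hd[OF v(1), of vs, folded bv] unfolding ws_def .
  hence ws0: "ws ! 0 = v" using n ws by (subst hd_conv_nth[symmetric]) auto
  have wsc: "ws ! i \<in> carrier_vec n" if "i < n" for i using ws that by auto
  define a where "a i = complex_of_real (1 / vec_norm2 (ws ! i))" for i
  define us where "us = map (\<lambda>i. a i \<cdot>\<^sub>v (ws ! i)) [0..<n]"
  define W where "W = mat_of_cols n us"
  have W: "W \<in> carrier_mat n n" by (simp add: W_def us_def mat_of_cols_def)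
  have colW: "col W i = a i \<cdot>\<^sub>v (ws ! i)" if "i < n" for i
    using that wsc by (simp add: W_def us_def)
  have "mat_adjoint W * W = 1\<^sub>m n"
  proof (rule eq_matI)
    fix i j assume ij: "i < dim_row (1\<^sub>m n)" "j < dim_col (1\<^sub>m n)"
    have "(mat_adjoint W * W) $$ (i, j) = conjugate (col W i) \<bullet> col W j"
      using ij W by (auto simp: scalar_prod_def)
    also have "\<dots> = col W j \<bullet>c col W i"
      using ij W by (intro comm_scalar_prod[of _ n]) auto
    also have "\<dots> = a j * a i * (ws ! j \<bullet>c ws ! i)"
    proof -
      have "col W j \<bullet>c col W i = (a j \<cdot>\<^sub>v ws ! j) \<bullet> (a i \<cdot>\<^sub>v conjugate (ws ! i))"
        using ij by (simp add: colW conjugate_smult_vec a_def)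
      also have "\<dots> = a j * (ws ! j \<bullet> (a i \<cdot>\<^sub>v conjugate (ws ! i)))"
        using ij wsc by (intro smult_scalar_prod_distrib[of _ n]) auto
      also have "ws ! j \<bullet> (a i \<cdot>\<^sub>v conjugate (ws ! i)) = a i * (ws ! j \<bullet>c ws ! i)"
        using ij wsc by (intro scalar_prod_smult_distrib[of _ n]) auto
      finally show ?thesis by simp
    qed
    also have "\<dots> = 1\<^sub>m n $$ (i, j)"
    proof (cases "i = j")
      case True
      have "ws ! i \<bullet>c ws ! i \<noteq> 0"
        using corthogonalD[OF ws(2), of i i] ij ws by auto
      thus ?thesis using True ij
        by (simp add: a_def cscalar_self power2_eq_square)
    next
      case False
      thus ?thesis using corthogonalD[OF ws(2), of j i] ij ws by auto
    qed
    finally show "(mat_adjoint W * W) $$ (i, j) = 1\<^sub>m n $$ (i, j)" .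
  qed (use W in auto)
  with W n colW[of 0] ws0 show ?thesis by (intro that[of W "a 0"]) auto
qed

lemma block_diag_mult:
  assumes "A \<in> carrier_mat p p" "A' \<in> carrier_mat p p" "D \<in> carrier_mat k k" "D' \<in> carrier_mat k k"
  shows "four_block_mat A (0\<^sub>m p k) (0\<^sub>m k p) D * four_block_mat A' (0\<^sub>m p k) (0\<^sub>m k p) D'
    = four_block_mat (A * A') (0\<^sub>m p k) (0\<^sub>m k p) (D * D')"
proof -
  have "A * A' \<in> carrier_mat p p" "D * D' \<in> carrier_mat k k"
    using assms by (auto intro: mult_carrier_mat)
  thus ?thesis
    by (subst mult_four_block_mat[of _ p p _ k _ k _ _ p _ k])
      (use assms in \<open>simp_all add: left_mult_zero_mat right_mult_zero_mat\<close>)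
qed

lemma mat_mult_regroup:
  assumes "A \<in> carrier_mat n n" "B \<in> carrier_mat n n" "C \<in> carrier_mat n n" "D \<in> carrier_mat n n"
  shows "(A * B) * (C * D) = A * (B * C) * D"
  using assms by (simp add: assoc_mult_mat[of _ n n _ n _ n])

text \<open>Deflation. In a unitary basis that starts with an eigenvector the first column of the matrix is a
  multiple of the first unit vector; by symmetry so is the first row, and the remaining block is
  Hermitian of smaller size.\<close>

lemma hermitian_diagonalizable:
  fixes M :: "complex mat"
  assumes "M \<in> carrier_mat n n" "mat_adjoint M = M"
  shows "\<exists>U d. U \<in> carrier_mat n n \<and> mat_adjoint U * U = 1\<^sub>m n \<and>
    M = U * mat_diag n d * mat_adjoint U"
  using assms
proof (induction n arbitrary: M)
  case 0
  have "M = 1\<^sub>m 0 * mat_diag 0 (\<lambda>_. 0) * mat_adjoint (1\<^sub>m 0)"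
    using 0 by (intro eq_matI) auto
  moreover have "mat_adjoint (1\<^sub>m 0) * 1\<^sub>m 0 = (1\<^sub>m 0 :: complex mat)"
    by (intro eq_matI) auto
  ultimately show ?case by (intro exI[of _ "1\<^sub>m 0"] exI[of _ "\<lambda>_. 0"]) auto
next
  case (Suc k)
  note M = Suc.prems(1)
  obtain e where "e \<in> spectrum M" using spectrum_non_empty[OF M] by auto
  then obtain v where "eigenvector M v e" by (auto simp: spectrum_def eigenvalue_def)
  hence v: "v \<in> carrier_vec (Suc k)" "v \<noteq> 0\<^sub>v (Suc k)" "M *\<^sub>v v = e \<cdot>\<^sub>v v"
    using M by (auto simp: eigenvector_def)
  obtain W c where W: "W \<in> carrier_mat (Suc k) (Suc k)" "mat_adjoint W * W = 1\<^sub>m (Suc k)"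
    and col: "col W 0 = c \<cdot>\<^sub>v v"
    using unitary_with_first_column[OF v(1,2)] by metis
  have W': "mat_adjoint W \<in> carrier_mat (Suc k) (Suc k)" using W by simp
  have WW: "W * mat_adjoint W = 1\<^sub>m (Suc k)"
    by (rule mat_mult_left_right_inverse[OF W' W(1) W(2)])
  define A where "A = mat_adjoint W * (M * W)"
  have A: "A \<in> carrier_mat (Suc k) (Suc k)" unfolding A_def by (intro mult_carrier_mat[OF W' mult_carrier_mat[OF M W(1)]])
  have Aadj: "mat_adjoint A = A"
  proof -
    have "mat_adjoint A = mat_adjoint (M * W) * mat_adjoint (mat_adjoint W)"
      unfolding A_def by (rule mat_adjoint_mult[OF W' mult_carrier_mat[OF M W(1)]])
    also have "mat_adjoint (M * W) = mat_adjoint W * M"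
      using mat_adjoint_mult[OF M W(1)] Suc.prems by simp
    finally show ?thesis
      unfolding A_def using assoc_mult_mat[OF W' M W(1)] by simp
  qed
  have A0: "A $$ (i, 0) = (if i = 0 then e else 0)" if i: "i < Suc k" for i
  proof -
    have "M *\<^sub>v col W 0 = e \<cdot>\<^sub>v col W 0"
      using v M by (simp add: col mult_mat_vec[of _ _ "Suc k"] smult_smult_assoc mult.commute)
    hence MW: "col (M * W) 0 = e \<cdot>\<^sub>v col W 0"
      using M W by (subst col_mult2[of _ "Suc k" "Suc k" _ "Suc k"]) auto
    have "A $$ (i, 0) = row (mat_adjoint W) i \<bullet> col (M * W) 0"
      unfolding A_def using i M W by (subst index_mult_mat) auto
    also have "\<dots> = e * (row (mat_adjoint W) i \<bullet> col W 0)"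
      unfolding MW
    proof (rule scalar_prod_smult_distrib)
      show "row (mat_adjoint W) i \<in> carrier_vec (Suc k)" using W i by (intro carrier_vecI) auto
      show "col W 0 \<in> carrier_vec (Suc k)" using W by (intro carrier_vecI) auto
    qed
    also have "row (mat_adjoint W) i \<bullet> col W 0 = (mat_adjoint W * W) $$ (i, 0)"
      using i W by (subst index_mult_mat) auto
    finally show ?thesis using i by (simp add: W(2))
  qed
  have A0': "A $$ (0, j) = (if j = 0 then e else 0)" if j: "j < Suc k" for j
  proof -
    have swap: "A $$ (i, j) = cnj (A $$ (j, i))" if "i < Suc k" for i
      using Aadj mat_adjoint_index[of i A j] A that j by auto
    show ?thesis
      using swap[of 0] A0[of j] A0[of 0] j Aadj mat_adjoint_index[of 0 A 0] A by (cases "j = 0") auto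
  qed
  define M' where "M' = Matrix.mat k k (\<lambda>(i, j). A $$ (Suc i, Suc j))"
  have M': "M' \<in> carrier_mat k k" by (simp add: M'_def)
  have "mat_adjoint M' = M'"
  proof (rule eq_matI)
    fix i j assume "i < dim_row M'" "j < dim_col M'"
    thus "mat_adjoint M' $$ (i, j) = M' $$ (i, j)"
      using Aadj mat_adjoint_index[of "Suc i" A "Suc j"] A by (simp add: M'_def)
  qed (use M' in auto)
  from Suc.IH[OF M' this] obtain U d where U: "U \<in> carrier_mat k k"
    "mat_adjoint U * U = 1\<^sub>m k" "M' = U * mat_diag k d * mat_adjoint U" by blast
  define X where "X = four_block_mat (1\<^sub>m 1) (0\<^sub>m 1 k) (0\<^sub>m k 1) U"
  define d' where "d' i = (if i = 0 then e else d (i - 1))" for i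
  have X: "X \<in> carrier_mat (Suc k) (Suc k)" unfolding X_def using U by auto
  have X': "mat_adjoint X = four_block_mat (1\<^sub>m 1) (0\<^sub>m 1 k) (0\<^sub>m k 1) (mat_adjoint U)"
    unfolding X_def using U by (intro eq_matI) auto
  have D: "mat_diag (Suc k) d' = four_block_mat (mat_diag 1 (\<lambda>_. e)) (0\<^sub>m 1 k) (0\<^sub>m k 1) (mat_diag k d)"
    by (intro eq_matI) (auto simp: mat_diag_def d'_def)
  have AB: "A = four_block_mat (mat_diag 1 (\<lambda>_. e)) (0\<^sub>m 1 k) (0\<^sub>m k 1) M'"
    using A A0 A0' by (intro eq_matI) (auto simp: mat_diag_def M'_def)
  have XX: "mat_adjoint X * X = 1\<^sub>m (Suc k)"
  proof -
    have "mat_adjoint X * X = four_block_mat (1\<^sub>m 1 * 1\<^sub>m 1) (0\<^sub>m 1 k) (0\<^sub>m k 1) (mat_adjoint U * U)"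
      unfolding X' unfolding X_def using U by (intro block_diag_mult) auto
    thus ?thesis using U by simp
  qed
  have dims: "mat_diag k d \<in> carrier_mat k k" "mat_diag 1 (\<lambda>_. e) \<in> carrier_mat 1 1"
    "U * mat_diag k d \<in> carrier_mat k k" "mat_adjoint U \<in> carrier_mat k k"
    "X * mat_diag (Suc k) d' \<in> carrier_mat (Suc k) (Suc k)"
    using U X by (auto intro!: mult_carrier_mat mat_diag_dim)
  have "X * mat_diag (Suc k) d'
      = four_block_mat (1\<^sub>m 1 * mat_diag 1 (\<lambda>_. e)) (0\<^sub>m 1 k) (0\<^sub>m k 1) (U * mat_diag k d)"
    unfolding X_def D by (rule block_diag_mult[OF one_carrier_mat dims(2) U(1) dims(1)])
  hence XD: "X * mat_diag (Suc k) d' = four_block_mat (mat_diag 1 (\<lambda>_. e)) (0\<^sub>m 1 k) (0\<^sub>m k 1) (U * mat_diag k d)"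
    unfolding left_mult_one_mat[OF dims(2)] .
  have "X * mat_diag (Suc k) d' * mat_adjoint X
      = four_block_mat (mat_diag 1 (\<lambda>_. e) * 1\<^sub>m 1) (0\<^sub>m 1 k) (0\<^sub>m k 1) (U * mat_diag k d * mat_adjoint U)"
    unfolding XD X' by (rule block_diag_mult[OF dims(2) one_carrier_mat dims(3,4)])
  hence XDX: "X * mat_diag (Suc k) d' * mat_adjoint X = A"
    unfolding AB U(3) right_mult_one_mat[OF dims(2)] .
  define Y where "Y = W * X"
  have Y: "Y \<in> carrier_mat (Suc k) (Suc k)" using W X by (simp add: Y_def)
  have Y': "mat_adjoint Y = mat_adjoint X * mat_adjoint W"
    unfolding Y_def by (rule mat_adjoint_mult[OF W(1) X])
  have "mat_adjoint Y * Y = mat_adjoint X * (mat_adjoint W * W) * X"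
    unfolding Y' unfolding Y_def by (rule mat_mult_regroup) (use W X in auto)
  hence YY: "mat_adjoint Y * Y = 1\<^sub>m (Suc k)" using W X XX by simp
  have "Y * mat_diag (Suc k) d' * mat_adjoint Y = (W * (X * mat_diag (Suc k) d')) * (mat_adjoint X * mat_adjoint W)"
    unfolding Y' unfolding Y_def assoc_mult_mat[OF W(1) X mat_diag_dim] ..
  also have "\<dots> = W * A * mat_adjoint W"
    unfolding XDX[symmetric] by (rule mat_mult_regroup) (use W X dims in auto)
  also have "\<dots> = (W * mat_adjoint W) * (M * W * mat_adjoint W)"
    unfolding A_def by (rule mat_mult_regroup[symmetric, OF W(1) W' mult_carrier_mat[OF M W(1)] W'])
  also have "M * W * mat_adjoint W = M"
    using assoc_mult_mat[OF M W(1) W'] WW M by simp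
  also have "W * mat_adjoint W * M = M" using WW M by simp
  finally show ?case using Y YY by metis
qed

text \<open>For a matrix diagonalised by \<open>U\<close> with eigenvalues \<open>d l\<close>, this is the functional calculus: \<open>f\<close> of the
  matrix is obtained from \<open>g = f \<circ> d\<close>.\<close>

definition spectral_mat :: "complex mat \<Rightarrow> nat \<Rightarrow> (nat \<Rightarrow> complex) \<Rightarrow> complex mat" where
  "spectral_mat U n g = U * mat_diag n g * mat_adjoint U"

definition unitary_mat :: "nat \<Rightarrow> complex mat \<Rightarrow> bool" where
  "unitary_mat n U \<longleftrightarrow> U \<in> carrier_mat n n \<and> mat_adjoint U * U = 1\<^sub>m n"

context
  fixes n U
  assumes U: "unitary_mat n U"
begin

private lemma c [simp]: "U \<in> carrier_mat n n" "mat_adjoint U \<in> carrier_mat n n"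
  "mat_diag n g \<in> carrier_mat n n"
  using U by (auto simp: unitary_mat_def)

private lemma UU: "mat_adjoint U * U = 1\<^sub>m n" "U * mat_adjoint U = 1\<^sub>m n"
  using U mat_mult_left_right_inverse[OF c(2) c(1)] by (auto simp: unitary_mat_def)

lemma spectral_mat_carrier [simp]: "spectral_mat U n g \<in> carrier_mat n n"
  unfolding spectral_mat_def by (intro mult_carrier_mat[of _ n n] c)

lemma spectral_mat_dim [simp]:
  "dim_row (spectral_mat U n g) = n" "dim_col (spectral_mat U n g) = n"
  using spectral_mat_carrier by blast+

lemma spectral_mat_index:
  assumes "i < n" "j < n"
  shows "spectral_mat U n g $$ (i, j) = (\<Sum>l<n. U $$ (i, l) * g l * cnj (U $$ (j, l)))"
proof -
  have d: "dim_row U = n" "dim_col U = n" using c(1) by blast+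
  show ?thesis
    unfolding spectral_mat_def mat_diag_mult_right[OF c(1)]
    using assms d by (simp add: scalar_prod_def atLeast0LessThan)
qed

lemma spectral_mat_cong:
  "(\<And>l. l < n \<Longrightarrow> f l = g l) \<Longrightarrow> spectral_mat U n f = spectral_mat U n g"
  by (intro eq_matI) (auto simp: spectral_mat_index)

lemma spectral_mat_mult: "spectral_mat U n f * spectral_mat U n g = spectral_mat U n (\<lambda>l. f l * g l)"
proof -
  let ?F = "mat_diag n f" and ?G = "mat_diag n g"
  have "spectral_mat U n f * spectral_mat U n g = U * (?F * ((mat_adjoint U * U) * (?G * mat_adjoint U)))"
    unfolding spectral_mat_def by (simp add: assoc_mult_mat[of _ n n _ n _ n] mult_carrier_mat[of _ n n _ n])
  also have "\<dots> = U * (?F * ?G) * mat_adjoint U"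
    unfolding UU(1) by (simp add: assoc_mult_mat[of _ n n _ n _ n] mult_carrier_mat[of _ n n _ n]
        left_mult_one_mat[of _ n n] del: mat_diag_diag)
  finally show ?thesis unfolding spectral_mat_def by simp
qed

lemma spectral_mat_one: "spectral_mat U n (\<lambda>_. 1) = 1\<^sub>m n"
  unfolding spectral_mat_def by (simp add: right_mult_one_mat[of _ n n] UU)

lemma spectral_mat_pow: "spectral_mat U n g ^\<^sub>m k = spectral_mat U n (\<lambda>l. g l ^ k)"
  by (induction k) (simp_all add: spectral_mat_one spectral_mat_mult mult.commute)

lemma spectral_mat_diff: "spectral_mat U n f - spectral_mat U n g = spectral_mat U n (\<lambda>l. f l - g l)"
  by (intro eq_matI) (auto simp: spectral_mat_index algebra_simps sum_subtractf)

lemma spectral_mat_smult: "a \<cdot>\<^sub>m spectral_mat U n g = spectral_mat U n (\<lambda>l. a * g l)"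
  by (intro eq_matI) (auto simp: spectral_mat_index algebra_simps sum_distrib_left)

lemma spectral_mat_adjoint: "mat_adjoint (spectral_mat U n g) = spectral_mat U n (\<lambda>l. cnj (g l))"
  by (intro eq_matI) (auto simp: spectral_mat_index algebra_simps)

text \<open>Conjugating back with \<open>U\<close> recovers the diagonal matrix. Applied to a Hermitian matrix and its
  adjoint, this shows that the eigenvalues are real.\<close>

lemma spectral_mat_inj:
  assumes "spectral_mat U n f = spectral_mat U n g" "l < n"
  shows "f l = g l"
proof -
  have "mat_adjoint U * (spectral_mat U n f * U) = mat_diag n f" for f
  proof -
    have "mat_adjoint U * (spectral_mat U n f * U)
        = (mat_adjoint U * U) * (mat_diag n f * (mat_adjoint U * U))"
      unfolding spectral_mat_def by (simp add: assoc_mult_mat[of _ n n _ n _ n] mult_carrier_mat[of _ n n _ n])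
    thus ?thesis unfolding UU(1) by (simp add: left_mult_one_mat[of _ n n] right_mult_one_mat[of _ n n])
  qed
  hence "mat_diag n f = mat_diag n g" using assms(1) by metis
  hence "mat_diag n f $$ (l, l) = mat_diag n g $$ (l, l)" by simp
  thus ?thesis using assms(2) by (simp add: mat_diag_def)
qed

lemma spectral_mat_vec:
  assumes "x \<in> carrier_vec n"
  shows "spectral_mat U n g *\<^sub>v x = U *\<^sub>v Matrix.vec n (\<lambda>l. g l * vec_index (mat_adjoint U *\<^sub>v x) l)"
proof -
  have d: "dim_row U = n" "dim_col U = n" using c(1) by blast+
  have dx: "dim_vec x = n" using assms by (rule carrier_vecD)
  have "spectral_mat U n g *\<^sub>v x = (U * mat_diag n g) *\<^sub>v (mat_adjoint U *\<^sub>v x)"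
    unfolding spectral_mat_def by (rule assoc_mult_mat_vec[of _ n n _ n])
      (use assms in \<open>auto intro: mult_carrier_mat[of _ n n]\<close>)
  also have "\<dots> = U *\<^sub>v (mat_diag n g *\<^sub>v (mat_adjoint U *\<^sub>v x))"
    by (rule assoc_mult_mat_vec[of _ n n _ n]) (use assms in \<open>auto intro: mult_mat_vec_carrier[of _ n n]\<close>)
  also have "mat_diag n g *\<^sub>v (mat_adjoint U *\<^sub>v x) = Matrix.vec n (\<lambda>l. g l * vec_index (mat_adjoint U *\<^sub>v x) l)"
  proof (rule eq_vecI)
    fix i assume i: "i < dim_vec (Matrix.vec n (\<lambda>l. g l * vec_index (mat_adjoint U *\<^sub>v x) l))"
    have "vec_index (mat_diag n g *\<^sub>v (mat_adjoint U *\<^sub>v x)) i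
        = (\<Sum>j<n. (if i = j then g j else 0) * vec_index (mat_adjoint U *\<^sub>v x) j)"
      using i d by (simp add: mat_diag_def scalar_prod_def atLeast0LessThan)
    also have "\<dots> = (\<Sum>j<n. if i = j then g j * vec_index (mat_adjoint U *\<^sub>v x) j else 0)"
      by (intro sum.cong) auto
    also have "\<dots> = g i * vec_index (mat_adjoint U *\<^sub>v x) i"
      using i by (subst sum.delta') auto
    finally show "vec_index (mat_diag n g *\<^sub>v (mat_adjoint U *\<^sub>v x)) i =
        vec_index (Matrix.vec n (\<lambda>l. g l * vec_index (mat_adjoint U *\<^sub>v x) l)) i" using i by simp
  qed (simp add: mat_diag_def)
  finally show ?thesis .
qed

lemma spectral_mat_norm_le:
  assumes x: "x \<in> carrier_vec n" and g: "\<And>l. l < n \<Longrightarrow> cmod (g l) \<le> E"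
  shows "vec_norm2 (spectral_mat U n g *\<^sub>v x) \<le> E * vec_norm2 x"
proof (cases "n = 0")
  case True
  thus ?thesis unfolding vec_norm2_def using spectral_mat_dim(1)[of g] carrier_vecD[OF x] by simp
next
  case False
  hence E: "E \<ge> 0" using g[of 0] norm_ge_zero[of "g 0"] by linarith
  let ?y = "mat_adjoint U *\<^sub>v x"
  have y: "?y \<in> carrier_vec n" using x by (intro mult_mat_vec_carrier[of _ n n] c)
  have dy: "dim_vec ?y = n" using y by (rule carrier_vecD)
  have "vec_norm2 (spectral_mat U n g *\<^sub>v x) = vec_norm2 (Matrix.vec n (\<lambda>l. g l * vec_index ?y l))"
    unfolding spectral_mat_vec[OF x] by (rule vec_norm2_isometry[OF c(1) UU(1)]) simp
  also have "\<dots> = L2_set (\<lambda>l. cmod (g l) * cmod (vec_index ?y l)) {..<n}"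
    unfolding vec_norm2_def by (simp add: norm_mult L2_set_def)
  also have "\<dots> \<le> L2_set (\<lambda>l. E * cmod (vec_index ?y l)) {..<n}"
    by (intro L2_set_mono mult_right_mono g) auto
  also have "\<dots> = E * vec_norm2 ?y"
    unfolding vec_norm2_def dy by (rule L2_set_right_distrib[OF E, symmetric])
  also have "vec_norm2 ?y = vec_norm2 x"
    using vec_norm2_isometry[of "mat_adjoint U" n n x] UU x by simp
  finally show ?thesis .
qed

lemma spectral_mat_exp:
  "mat_exp (a \<cdot>\<^sub>m spectral_mat U n g) = spectral_mat U n (\<lambda>l. exp (a * g l))"
proof (rule eq_matI)
  fix i j assume ij: "i < dim_row (spectral_mat U n (\<lambda>l. exp (a * g l)))"
    "j < dim_col (spectral_mat U n (\<lambda>l. exp (a * g l)))"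
  hence ij: "i < n" "j < n" by auto
  have "(\<lambda>k. \<Sum>l<n. U $$ (i, l) * ((a * g l) ^ k /\<^sub>R fact k) * cnj (U $$ (j, l)))
      sums (\<Sum>l<n. U $$ (i, l) * exp (a * g l) * cnj (U $$ (j, l)))"
    by (intro sums_sum sums_mult sums_mult2 exp_converges)
  also have "(\<lambda>k. \<Sum>l<n. U $$ (i, l) * ((a * g l) ^ k /\<^sub>R fact k) * cnj (U $$ (j, l)))
      = (\<lambda>k. ((a \<cdot>\<^sub>m spectral_mat U n g) ^\<^sub>m k) $$ (i, j) / fact k)"
    unfolding spectral_mat_smult spectral_mat_pow
    using ij by (simp add: spectral_mat_index scaleR_conv_of_real sum_divide_distrib field_simps)
  finally show "mat_exp (a \<cdot>\<^sub>m spectral_mat U n g) $$ (i, j) = spectral_mat U n (\<lambda>l. exp (a * g l)) $$ (i, j)"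
    using ij by (simp add: mat_exp_def spectral_mat_index sums_iff)
qed (auto simp: mat_exp_def)

lemma spectral_mat_shift:
  "complex_of_real q \<cdot>\<^sub>m 1\<^sub>m n - spectral_mat U n g = spectral_mat U n (\<lambda>l. complex_of_real q - g l)"
  by (simp add: spectral_mat_one[symmetric] spectral_mat_smult spectral_mat_diff)

lemma spectral_mat_shift_inverse:
  assumes "\<And>l. l < n \<Longrightarrow> g l \<noteq> complex_of_real q"
  shows "shift_inverse (spectral_mat U n g) q = spectral_mat U n (\<lambda>l. 1 / (complex_of_real q - g l))"
proof -
  let ?A = "spectral_mat U n (\<lambda>l. complex_of_real q - g l)"
  let ?B = "spectral_mat U n (\<lambda>l. 1 / (complex_of_real q - g l))"
  have inv: "?A * ?B = 1\<^sub>m n" "?B * ?A = 1\<^sub>m n"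
    unfolding spectral_mat_mult spectral_mat_one[symmetric]
    by (rule spectral_mat_cong; use assms in force)+
  have "?A \<in> Units (ring_mat TYPE(complex) n ())"
    unfolding Units_def using inv by (auto simp: ring_mat_def intro!: bexI[of _ ?B])
  then obtain C where C: "mat_inverse ?A = Some C"
    using mat_inverse(1)[OF spectral_mat_carrier, where b = "()"] by (cases "mat_inverse ?A") auto
  note C' = mat_inverse(2)[OF spectral_mat_carrier C]
  have Cc: "C \<in> carrier_mat n n" using C' by blast
  have "C = C * (?A * ?B)" using inv Cc by simp
  also have "\<dots> = (C * ?A) * ?B"
    by (rule assoc_mult_mat[symmetric, OF Cc spectral_mat_carrier spectral_mat_carrier])
  also have "\<dots> = ?B" using C' by simp
  finally show ?thesis using C by (simp add: shift_inverse_def spectral_mat_shift)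
qed

end

lemma hermitian_nsd_spectral:
  assumes "hermitian_nsd n A"
  obtains U d where "unitary_mat n U" "A = spectral_mat U n (\<lambda>l. complex_of_real (d l))"
    "\<And>l. l < n \<Longrightarrow> d l \<le> (0 :: real)"
proof -
  have A: "A \<in> carrier_mat n n" and adj: "mat_adjoint A = A"
    and nsd: "\<And>v. v \<in> carrier_vec n \<Longrightarrow> Re ((A *\<^sub>v v) \<bullet>c v) \<le> 0"
    using assms by (auto simp: hermitian_nsd_def)
  obtain U g where U: "unitary_mat n U" and AU: "A = spectral_mat U n g"
    using hermitian_diagonalizable[OF A adj] unfolding unitary_mat_def spectral_mat_def by blast
  have Uc: "U \<in> carrier_mat n n" and UU: "mat_adjoint U * U = 1\<^sub>m n"
    using U by (auto simp: unitary_mat_def)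
  have real: "g l = complex_of_real (Re (g l))" if "l < n" for l
  proof -
    have "cnj (g l) = g l"
      using adj spectral_mat_inj[OF U, of "\<lambda>l. cnj (g l)" g l] that
      unfolding AU spectral_mat_adjoint[OF U] by simp
    thus ?thesis by (metis Reals_cnj_iff of_real_Re)
  qed
  have neg: "Re (g l) \<le> 0" if l: "l < n" for l
  proof -
    define e where "e = (unit_vec n l :: complex vec)"
    have e: "e \<in> carrier_vec n" by (simp add: e_def)
    have UUe: "mat_adjoint U *\<^sub>v (U *\<^sub>v e) = e"
      using assoc_mult_mat_vec[OF mat_adjoint_carrier[OF Uc] Uc e] UU e by simp
    have "A *\<^sub>v (U *\<^sub>v e) = U *\<^sub>v Matrix.vec n (\<lambda>l. g l * vec_index e l)"
      unfolding AU using spectral_mat_vec[OF U, of "U *\<^sub>v e" g] Uc e UUe by simp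
    also have "Matrix.vec n (\<lambda>l. g l * vec_index e l) = g l \<cdot>\<^sub>v e"
      using l by (intro eq_vecI) (auto simp: e_def)
    finally have "(A *\<^sub>v (U *\<^sub>v e)) \<bullet>c (U *\<^sub>v e) = (U *\<^sub>v (g l \<cdot>\<^sub>v e)) \<bullet>c (U *\<^sub>v e)" by simp
    also have "\<dots> = (g l \<cdot>\<^sub>v e) \<bullet>c e"
      using mult_mat_vec_cscalar[OF Uc, of "g l \<cdot>\<^sub>v e" "U *\<^sub>v e"] Uc e UUe by simp
    also have "\<dots> = g l"
      using l e by (simp add: e_def scalar_prod_def if_distrib cong: if_cong)
    finally show ?thesis using nsd[of "U *\<^sub>v e"] Uc e by simp
  qed
  show ?thesis
  proof (rule that[OF U])
    show "A = spectral_mat U n (\<lambda>l. complex_of_real (Re (g l)))"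
      unfolding AU by (rule spectral_mat_cong[OF U]) (rule real)
  qed (rule neg)
qed

section \<open>Quasi-optimality of the shift-and-invert approximation\<close>

text \<open>The vectors fixed by \<open>V V\<^sup>*\<close> form a subspace that contains the columns of \<open>V\<close>, hence their span.\<close>

lemma cspan_cols_projection:
  assumes V: "V \<in> carrier_mat n k" "mat_adjoint V * V = 1\<^sub>m k"
    and x: "x \<in> cspan n (set (cols V))"
  shows "x \<in> carrier_vec n" "V *\<^sub>v (mat_adjoint V *\<^sub>v x) = x"
proof -
  interpret vec_space "TYPE(complex)" n .
  have V': "mat_adjoint V \<in> carrier_mat k n" using V by simp
  define N where "N = {y \<in> carrier_vec n. V *\<^sub>v (mat_adjoint V *\<^sub>v y) = y}"
  have sub: "submodule class_ring N (module_vec TYPE(complex) n)"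
  proof (unfold_locales, goal_cases)
    case 1 show ?case by (auto simp: N_def)
  next
    case (2 v w)
    hence vw: "v \<in> carrier_vec n" "w \<in> carrier_vec n"
      "V *\<^sub>v (mat_adjoint V *\<^sub>v v) = v" "V *\<^sub>v (mat_adjoint V *\<^sub>v w) = w"
      by (auto simp: N_def)
    have "V *\<^sub>v (mat_adjoint V *\<^sub>v (v + w)) = v + w"
      using mult_add_distrib_mat_vec[OF V' vw(1,2)] vw(3,4)
        mult_add_distrib_mat_vec[OF V(1) mult_mat_vec_carrier[OF V' vw(1)] mult_mat_vec_carrier[OF V' vw(2)]]
      by simp
    thus ?case using vw by (simp add: N_def)
  next
    case 3
    have "mat_adjoint V *\<^sub>v 0\<^sub>v n = 0\<^sub>v k" "V *\<^sub>v 0\<^sub>v k = 0\<^sub>v n"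
      using V by (auto intro!: eq_vecI simp: scalar_prod_def)
    thus ?case by (simp add: N_def)
  next
    case (4 c v)
    hence v: "v \<in> carrier_vec n" "V *\<^sub>v (mat_adjoint V *\<^sub>v v) = v" by (auto simp: N_def)
    have "V *\<^sub>v (mat_adjoint V *\<^sub>v (c \<cdot>\<^sub>v v)) = c \<cdot>\<^sub>v v"
      using mult_mat_vec[OF V' v(1)] mult_mat_vec[OF V(1) mult_mat_vec_carrier[OF V' v(1)]] v(2) by simp
    thus ?case using v by (simp add: N_def)
  qed
  have "set (cols V) \<subseteq> N"
  proof
    fix y assume "y \<in> set (cols V)"
    then obtain j where j: "j < k" "y = col V j"
      using V by (auto simp: cols_def)
    have "y = V *\<^sub>v unit_vec k j" using j V by (auto intro!: eq_vecI simp: scalar_prod_def if_distrib cong: if_cong)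
    moreover have "mat_adjoint V *\<^sub>v (V *\<^sub>v unit_vec k j) = unit_vec k j"
      using assoc_mult_mat_vec[OF V' V(1), of "unit_vec k j"] V(2) by simp
    ultimately show "y \<in> N" using V(1) by (simp add: N_def mult_mat_vec_carrier[of _ n k])
  qed
  hence "cspan n (set (cols V)) \<subseteq> N"
    unfolding cspan_def by (rule span_is_subset[OF _ sub])
  thus "x \<in> carrier_vec n" "V *\<^sub>v (mat_adjoint V *\<^sub>v x) = x"
    using x by (auto simp: N_def)
qed

lemma cspan_mem:
  assumes "S \<subseteq> carrier_vec n" "x \<in> S"
  shows "x \<in> cspan n S"
proof -
  interpret vec_space "TYPE(complex)" n .
  show ?thesis unfolding cspan_def using in_own_span[of S] assms by auto
qed

lemma compression_hermitian_nsd: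
  assumes A: "hermitian_nsd n A" and V: "V \<in> carrier_mat n k"
  shows "hermitian_nsd k (mat_adjoint V * A * V)"
proof -
  have A': "A \<in> carrier_mat n n" "mat_adjoint A = A"
    "\<And>v. v \<in> carrier_vec n \<Longrightarrow> Re ((A *\<^sub>v v) \<bullet>c v) \<le> 0"
    using A by (auto simp: hermitian_nsd_def)
  have V': "mat_adjoint V \<in> carrier_mat k n" using V by simp
  have AV: "A * V \<in> carrier_mat n k" by (rule mult_carrier_mat[OF A'(1) V])
  have B: "mat_adjoint V * A * V = mat_adjoint V * (A * V)"
    by (rule assoc_mult_mat[OF V' A'(1) V])
  have c: "mat_adjoint V * (A * V) \<in> carrier_mat k k" by (rule mult_carrier_mat[OF V' AV])
  have "mat_adjoint (mat_adjoint V * (A * V)) = mat_adjoint (A * V) * V"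
    using mat_adjoint_mult[OF V' AV] by simp
  also have "mat_adjoint (A * V) = mat_adjoint V * A"
    using mat_adjoint_mult[OF A'(1) V] A' by simp
  finally have adj: "mat_adjoint (mat_adjoint V * (A * V)) = mat_adjoint V * (A * V)"
    unfolding B .
  have "Re ((mat_adjoint V * (A * V) *\<^sub>v y) \<bullet>c y) \<le> 0" if y: "y \<in> carrier_vec k" for y
  proof -
    have Vy: "V *\<^sub>v y \<in> carrier_vec n" by (rule mult_mat_vec_carrier[OF V y])
    have "mat_adjoint V * (A * V) *\<^sub>v y = mat_adjoint V *\<^sub>v (A *\<^sub>v (V *\<^sub>v y))"
      by (simp only: assoc_mult_mat_vec[OF V' AV y] assoc_mult_mat_vec[OF A'(1) V y])
    hence "(mat_adjoint V * (A * V) *\<^sub>v y) \<bullet>c y = (A *\<^sub>v (V *\<^sub>v y)) \<bullet>c (V *\<^sub>v y)"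
      using mult_mat_vec_cscalar[OF V' mult_mat_vec_carrier[OF A'(1) Vy] y] by simp
    thus ?thesis using A'(3)[OF Vy] by simp
  qed
  thus ?thesis unfolding hermitian_nsd_def B using c adj by blast
qed

text \<open>If \<open>S = (z I - A)\<^sup>-\<^sup>1\<close> and \<open>y = S x\<close> lies in the range of \<open>V\<close>, then compressing the equation
  \<open>(z I - A) y = x\<close> gives an equation for \<open>V\<^sup>* y\<close> alone, whose matrix is \<open>z I\<close> minus the compression of
  \<open>A\<close>. So one resolvent step commutes with the passage to coordinates as long as its result stays in
  the space.\<close>

lemma krylov_compression_step:
  assumes A: "A \<in> carrier_mat n n" and S: "S \<in> carrier_mat n n" "(z \<cdot>\<^sub>m 1\<^sub>m n - A) * S = 1\<^sub>m n"
    and V: "V \<in> carrier_mat n k" "mat_adjoint V * V = 1\<^sub>m k"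
    and T: "T \<in> carrier_mat k k" "T * (z \<cdot>\<^sub>m 1\<^sub>m k - mat_adjoint V * A * V) = 1\<^sub>m k"
    and x: "x \<in> carrier_vec n" and proj: "V *\<^sub>v (mat_adjoint V *\<^sub>v (S *\<^sub>v x)) = S *\<^sub>v x"
  shows "mat_adjoint V *\<^sub>v (S *\<^sub>v x) = T *\<^sub>v (mat_adjoint V *\<^sub>v x)"
proof -
  have V': "mat_adjoint V \<in> carrier_mat k n" using V by simp
  define R where "R = z \<cdot>\<^sub>m 1\<^sub>m n - A"
  have R: "R \<in> carrier_mat n n" using A by (simp add: R_def minus_carrier_mat)
  have RV: "R * V \<in> carrier_mat n k" by (rule mult_carrier_mat[OF R V(1)])
  have "R * V = z \<cdot>\<^sub>m V - A * V"
    unfolding R_def using A V by (simp add: minus_mult_distrib_mat[of _ n n] mult_smult_assoc_mat[of _ n n])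
  hence "mat_adjoint V * (R * V) = mat_adjoint V * (z \<cdot>\<^sub>m V) - mat_adjoint V * (A * V)"
    using V' V A by (simp add: mult_minus_distrib_mat[OF V', of _ k] mult_carrier_mat[OF A V(1)])
  also have "mat_adjoint V * (z \<cdot>\<^sub>m V) = z \<cdot>\<^sub>m 1\<^sub>m k"
    using mult_smult_distrib[OF V' V(1)] V(2) by simp
  also have "mat_adjoint V * (A * V) = mat_adjoint V * A * V"
    by (rule assoc_mult_mat[OF V' A V(1), symmetric])
  finally have VRV: "T * (mat_adjoint V * (R * V)) = 1\<^sub>m k" using T by simp
  define y where "y = S *\<^sub>v x"
  have y: "y \<in> carrier_vec n" unfolding y_def by (rule mult_mat_vec_carrier[OF S(1) x])
  define w where "w = mat_adjoint V *\<^sub>v y"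
  have w: "w \<in> carrier_vec k" unfolding w_def by (rule mult_mat_vec_carrier[OF V' y])
  have Vw: "V *\<^sub>v w = y" using proj by (simp add: w_def y_def)
  have "R *\<^sub>v y = x"
    unfolding y_def using assoc_mult_mat_vec[OF R S(1) x] S(2) x by (simp add: R_def)
  hence "T *\<^sub>v (mat_adjoint V *\<^sub>v x) = T *\<^sub>v (mat_adjoint V *\<^sub>v (R *\<^sub>v (V *\<^sub>v w)))"
    by (simp add: Vw)
  also have "\<dots> = (T * (mat_adjoint V * (R * V))) *\<^sub>v w"
    by (simp only: assoc_mult_mat_vec[OF T(1) mult_carrier_mat[OF V' RV] w]
      assoc_mult_mat_vec[OF V' RV w] assoc_mult_mat_vec[OF R V(1) w])
  also have "\<dots> = w" unfolding VRV using w by simp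
  finally show ?thesis by (simp add: w_def y_def)
qed

lemma spectral_mat_vec_sum:
  assumes U: "unitary_mat n U" and x: "x \<in> carrier_vec n" and i: "i < n"
  shows "vec_index (spectral_mat U n (\<lambda>l. \<Sum>j\<le>m. c j * f j l) *\<^sub>v x) i
    = (\<Sum>j\<le>m. c j * vec_index (spectral_mat U n (f j) *\<^sub>v x) i)"
proof -
  have *: "vec_index (spectral_mat U n g *\<^sub>v x) i
      = (\<Sum>a<n. \<Sum>l<n. U $$ (i, l) * g l * cnj (U $$ (a, l)) * vec_index x a)" for g
    using i carrier_vecD[OF x] spectral_mat_dim[OF U]
    by (simp add: scalar_prod_def spectral_mat_index[OF U] atLeast0LessThan sum_distrib_right)
  have "vec_index (spectral_mat U n (\<lambda>l. \<Sum>j\<le>m. c j * f j l) *\<^sub>v x) i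
     = (\<Sum>a<n. \<Sum>l<n. \<Sum>j\<le>m. c j * (U $$ (i, l) * f j l * cnj (U $$ (a, l)) * vec_index x a))"
    unfolding * by (simp add: sum_distrib_left sum_distrib_right mult_ac)
  also have "\<dots> = (\<Sum>a<n. \<Sum>j\<le>m. \<Sum>l<n. c j * (U $$ (i, l) * f j l * cnj (U $$ (a, l)) * vec_index x a))"
    by (intro sum.cong refl sum.swap)
  also have "\<dots> = (\<Sum>j\<le>m. \<Sum>a<n. \<Sum>l<n. c j * (U $$ (i, l) * f j l * cnj (U $$ (a, l)) * vec_index x a))"
    by (rule sum.swap)
  finally show ?thesis unfolding * by (simp add: sum_distrib_left)
qed

lemma vec_diff_split:
  fixes x y z :: "complex vec"
  assumes "x \<in> carrier_vec n" "y \<in> carrier_vec n" "z \<in> carrier_vec n"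
  shows "x - z = (x - y) + (y - z)"
  using assms by (intro eq_vecI) auto

text \<open>By induction with \<open>krylov_compression_step\<close>, coordinates in \<open>V\<close> turn \<open>(q I - A)\<^sup>-\<^sup>j b\<close> into \<open>(q I - B)\<^sup>-\<^sup>j V\<^sup>* b\<close> for
  \<open>j \<le> m\<close>, with \<open>B = V\<^sup>* A V\<close>. Hence \<open>r(A) b = V r(B) V\<^sup>* b\<close> for every admissible rational function \<open>r\<close>;
  subtracting this vector splits the error into \<open>(exp - r)(A) b\<close> and \<open>V (r - exp)(B) V\<^sup>* b\<close>. The number \<open>X\<close>
  bounds both spectra; restricting the approximation to a compact interval is what allows the contour
  below to be a finite rectangle.\<close>

lemma si_error_quasi_optimal:
  assumes A: "hermitian_nsd n A" and b: "b \<in> carrier_vec n" and q: "q > 0"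
    and V: "si_basis A b q m V"
  obtains X where "\<And>c E. (\<And>x. -X \<le> x \<Longrightarrow> x \<le> 0 \<Longrightarrow>
      cmod (complex_of_real (exp (t * x)) - (\<Sum>j\<le>m. c j * complex_of_real (1 / (q - x)) ^ j)) \<le> E)
    \<Longrightarrow> si_error t A b V \<le> 2 * E * vec_norm2 b"
proof -
  have Ac: "A \<in> carrier_mat n n" using A by (simp add: hermitian_nsd_def)
  hence dimA: "dim_row A = n" by blast
  define k where "k = dim_col V"
  have Vc: "V \<in> carrier_mat n k"
    using V dimA by (intro carrier_matI) (simp_all add: si_basis_def k_def)
  have VV: "mat_adjoint V * V = 1\<^sub>m k" and sp: "cspan n (set (cols V)) = si_space A b q m"
    using V dimA by (simp_all add: si_basis_def k_def)
  have V'c: "mat_adjoint V \<in> carrier_mat k n" using Vc by simp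
  define B where "B = mat_adjoint V * A * V"
  have Bh: "hermitian_nsd k B" unfolding B_def by (rule compression_hermitian_nsd[OF A Vc])
  obtain U d where U: "unitary_mat n U" and AU: "A = spectral_mat U n (\<lambda>l. complex_of_real (d l))"
    and d: "\<And>l. l < n \<Longrightarrow> d l \<le> 0"
    using hermitian_nsd_spectral[OF A] by blast
  obtain W e where W: "unitary_mat k W" and BW: "B = spectral_mat W k (\<lambda>l. complex_of_real (e l))"
    and e: "\<And>l. l < k \<Longrightarrow> e l \<le> 0"
    using hermitian_nsd_spectral[OF Bh] by blast
  let ?q = "complex_of_real q"
  define \<sigma> where "\<sigma> l = complex_of_real (1 / (q - d l))" for l
  define \<tau> where "\<tau> l = complex_of_real (1 / (q - e l))" for l
  define S where "S = spectral_mat U n \<sigma>"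
  define T where "T = spectral_mat W k \<tau>"
  have Sc: "S \<in> carrier_mat n n" unfolding S_def by (rule spectral_mat_carrier[OF U])
  have Tc: "T \<in> carrier_mat k k" unfolding T_def by (rule spectral_mat_carrier[OF W])
  have S: "shift_inverse A q = S"
  proof -
    have "shift_inverse A q = spectral_mat U n (\<lambda>l. 1 / (?q - complex_of_real (d l)))"
      unfolding AU using d q by (intro spectral_mat_shift_inverse[OF U]) force
    thus ?thesis by (simp add: S_def \<sigma>_def[abs_def])
  qed
  have nz: "?q - complex_of_real (d l) \<noteq> 0" if "l < n" for l
    using d[OF that] q by (simp flip: of_real_diff)
  have nz': "?q - complex_of_real (e l) \<noteq> 0" if "l < k" for l
    using e[OF that] q by (simp flip: of_real_diff)
  have S1: "(?q \<cdot>\<^sub>m 1\<^sub>m n - A) * S = 1\<^sub>m n"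
    unfolding AU S_def spectral_mat_shift[OF U] spectral_mat_mult[OF U]
    by (subst spectral_mat_one[OF U, symmetric], rule spectral_mat_cong[OF U]) (use nz in \<open>simp add: \<sigma>_def\<close>)
  have T1: "T * (?q \<cdot>\<^sub>m 1\<^sub>m k - mat_adjoint V * A * V) = 1\<^sub>m k"
    unfolding B_def[symmetric]
    unfolding BW T_def spectral_mat_shift[OF W] spectral_mat_mult[OF W]
    by (subst spectral_mat_one[OF W, symmetric], rule spectral_mat_cong[OF W]) (use nz' in \<open>simp add: \<tau>_def\<close>)
  have Sj: "S ^\<^sub>m j *\<^sub>v b \<in> carrier_vec n" for j
    by (rule mult_mat_vec_carrier[OF pow_carrier_mat[OF Sc] b])
  have inspace: "S ^\<^sub>m j *\<^sub>v b \<in> cspan n (set (cols V))" if "j \<le> m" for j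
    unfolding sp si_space_def dimA S by (rule cspan_mem) (use Sj that in auto)
  have proj: "V *\<^sub>v (mat_adjoint V *\<^sub>v (S ^\<^sub>m j *\<^sub>v b)) = S ^\<^sub>m j *\<^sub>v b" if "j \<le> m" for j
    by (rule cspan_cols_projection(2)[OF Vc VV inspace[OF that]])
  have b': "mat_adjoint V *\<^sub>v b \<in> carrier_vec k" by (rule mult_mat_vec_carrier[OF V'c b])
  have step: "M ^\<^sub>m Suc j *\<^sub>v y = M *\<^sub>v (M ^\<^sub>m j *\<^sub>v y)"
    if "M \<in> carrier_mat N N" "y \<in> carrier_vec N" for M :: "complex mat" and N j y
  proof -
    have "M ^\<^sub>m Suc j = M * M ^\<^sub>m j"
    proof (induction j)
      case 0
      show ?case using that by simp
    next
      case (Suc j)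
      have "M ^\<^sub>m Suc (Suc j) = M * M ^\<^sub>m j * M" using Suc by simp
      also have "\<dots> = M * (M ^\<^sub>m j * M)"
        by (rule assoc_mult_mat[OF that(1) pow_carrier_mat[OF that(1)] that(1)])
      finally show ?case by simp
    qed
    thus ?thesis using assoc_mult_mat_vec[OF that(1) pow_carrier_mat[OF that(1)] that(2)] by simp
  qed
  have exact: "mat_adjoint V *\<^sub>v (S ^\<^sub>m j *\<^sub>v b) = T ^\<^sub>m j *\<^sub>v (mat_adjoint V *\<^sub>v b)" if "j \<le> m" for j
    using that
  proof (induction j)
    case 0
    thus ?case using b b' Sc Tc by simp
  next
    case (Suc j)
    have "mat_adjoint V *\<^sub>v (S *\<^sub>v (S ^\<^sub>m j *\<^sub>v b)) = T *\<^sub>v (mat_adjoint V *\<^sub>v (S ^\<^sub>m j *\<^sub>v b))"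
      using proj[OF Suc.prems] unfolding step[OF Sc b]
      by (intro krylov_compression_step[OF Ac Sc S1 Vc VV Tc T1 Sj])
    thus ?case using Suc by (simp only: step[OF Sc b] step[OF Tc b'] Suc_leD)
  qed
  have proj0: "V *\<^sub>v (mat_adjoint V *\<^sub>v b) = b" using proj[of 0] b Sc by simp
  have normb: "vec_norm2 (mat_adjoint V *\<^sub>v b) = vec_norm2 b"
    using vec_norm2_isometry[OF Vc VV b'] proj0 by simp
  define X where "X = (\<Sum>l<n. \<bar>d l\<bar>) + (\<Sum>l<k. \<bar>e l\<bar>)"
  have Xd: "- X \<le> d l" if "l < n" for l
  proof -
    have "\<bar>d l\<bar> \<le> (\<Sum>l<n. \<bar>d l\<bar>)" using that by (intro member_le_sum) auto
    moreover have "0 \<le> (\<Sum>l<k. \<bar>e l\<bar>)" by (intro sum_nonneg) auto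
    ultimately show ?thesis unfolding X_def by linarith
  qed
  have Xe: "- X \<le> e l" if "l < k" for l
  proof -
    have "\<bar>e l\<bar> \<le> (\<Sum>l<k. \<bar>e l\<bar>)" using that by (intro member_le_sum) auto
    moreover have "0 \<le> (\<Sum>l<n. \<bar>d l\<bar>)" by (intro sum_nonneg) auto
    ultimately show ?thesis unfolding X_def by linarith
  qed
  show ?thesis
  proof (rule that[of X])
    fix c :: "nat \<Rightarrow> complex" and E
    assume E: "\<And>x. -X \<le> x \<Longrightarrow> x \<le> 0 \<Longrightarrow>
      cmod (complex_of_real (exp (t * x)) - (\<Sum>j\<le>m. c j * complex_of_real (1 / (q - x)) ^ j)) \<le> E"
    define fA where "fA l = complex_of_real (exp (t * d l))" for l
    define rA where "rA l = (\<Sum>j\<le>m. c j * \<sigma> l ^ j)" for l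
    define fB where "fB l = complex_of_real (exp (t * e l))" for l
    define rB where "rB l = (\<Sum>j\<le>m. c j * \<tau> l ^ j)" for l
    let ?b = "mat_adjoint V *\<^sub>v b"
    note cA = mult_mat_vec_carrier[OF spectral_mat_carrier[OF U] b]
    note cB = mult_mat_vec_carrier[OF spectral_mat_carrier[OF W] b']
    have r: "V *\<^sub>v (spectral_mat W k rB *\<^sub>v ?b) = spectral_mat U n rA *\<^sub>v b"
    proof (rule eq_vecI)
      show "dim_vec (V *\<^sub>v (spectral_mat W k rB *\<^sub>v ?b)) = dim_vec (spectral_mat U n rA *\<^sub>v b)"
        using Vc carrier_vecD[OF cA] by simp
      fix i assume "i < dim_vec (spectral_mat U n rA *\<^sub>v b)"
      hence i: "i < n" using carrier_vecD[OF cA] by simp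
      have Vi: "vec_index (V *\<^sub>v y) i = (\<Sum>a<k. V $$ (i, a) * vec_index y a)"
        if "y \<in> carrier_vec k" for y
        using i Vc that by (auto simp: scalar_prod_def atLeast0LessThan)
      have "vec_index (V *\<^sub>v (spectral_mat W k rB *\<^sub>v ?b)) i
          = (\<Sum>a<k. \<Sum>j\<le>m. c j * (V $$ (i, a) * vec_index (T ^\<^sub>m j *\<^sub>v ?b) a))"
        unfolding Vi[OF cB] T_def spectral_mat_pow[OF W] rB_def
        by (intro sum.cong refl)
          (simp add: spectral_mat_vec_sum[OF W b'] sum_distrib_left mult_ac)
      also have "\<dots> = (\<Sum>j\<le>m. c j * (\<Sum>a<k. V $$ (i, a) * vec_index (T ^\<^sub>m j *\<^sub>v ?b) a))"
        by (subst sum.swap) (simp add: sum_distrib_left)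
      also have "\<dots> = (\<Sum>j\<le>m. c j * vec_index (S ^\<^sub>m j *\<^sub>v b) i)"
      proof (intro sum.cong refl)
        fix j assume "j \<in> {..m}"
        hence j: "j \<le> m" by simp
        show "c j * (\<Sum>a<k. V $$ (i, a) * vec_index (T ^\<^sub>m j *\<^sub>v ?b) a) = c j * vec_index (S ^\<^sub>m j *\<^sub>v b) i"
          using Vi[OF mult_mat_vec_carrier[OF pow_carrier_mat[OF Tc] b'], of j] exact[OF j] proj[OF j] by simp
      qed
      also have "\<dots> = vec_index (spectral_mat U n rA *\<^sub>v b) i"
        unfolding rA_def S_def spectral_mat_pow[OF U] spectral_mat_vec_sum[OF U b i] ..
      finally show "vec_index (V *\<^sub>v (spectral_mat W k rB *\<^sub>v ?b)) i = vec_index (spectral_mat U n rA *\<^sub>v b) i" .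
    qed
    have ex: "exp (complex_of_real t * complex_of_real x) = complex_of_real (exp (t * x))" for x
      by (simp add: exp_of_real flip: of_real_mult)
    have "mat_exp (complex_of_real t \<cdot>\<^sub>m A) *\<^sub>v b - si_approx t A b V
        = spectral_mat U n fA *\<^sub>v b - V *\<^sub>v (spectral_mat W k fB *\<^sub>v ?b)"
      unfolding si_approx_def B_def[symmetric]
      unfolding AU BW spectral_mat_exp[OF U] spectral_mat_exp[OF W] ex fA_def fB_def ..
    also have "\<dots> = (spectral_mat U n fA *\<^sub>v b - spectral_mat U n rA *\<^sub>v b)
       + (V *\<^sub>v (spectral_mat W k rB *\<^sub>v ?b) - V *\<^sub>v (spectral_mat W k fB *\<^sub>v ?b))"
      unfolding r by (rule vec_diff_split[OF cA cA mult_mat_vec_carrier[OF Vc cB]])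
    also have "spectral_mat U n fA *\<^sub>v b - spectral_mat U n rA *\<^sub>v b = spectral_mat U n (\<lambda>l. fA l - rA l) *\<^sub>v b"
      unfolding spectral_mat_diff[OF U, symmetric]
      by (rule minus_mult_distrib_mat_vec[symmetric, OF spectral_mat_carrier[OF U] spectral_mat_carrier[OF U] b])
    also have "V *\<^sub>v (spectral_mat W k rB *\<^sub>v ?b) - V *\<^sub>v (spectral_mat W k fB *\<^sub>v ?b)
       = V *\<^sub>v (spectral_mat W k (\<lambda>l. rB l - fB l) *\<^sub>v ?b)"
      unfolding spectral_mat_diff[OF W, symmetric]
      by (simp add: minus_mult_distrib_mat_vec[OF spectral_mat_carrier[OF W] spectral_mat_carrier[OF W] b']
          mult_minus_distrib_mat_vec[OF Vc cB cB])
    finally have "si_error t A b V \<le> vec_norm2 (spectral_mat U n (\<lambda>l. fA l - rA l) *\<^sub>v b)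
       + vec_norm2 (V *\<^sub>v (spectral_mat W k (\<lambda>l. rB l - fB l) *\<^sub>v ?b))"
      unfolding si_error_def using vec_norm2_triangle[OF cA mult_mat_vec_carrier[OF Vc cB]] by simp
    also have "vec_norm2 (V *\<^sub>v (spectral_mat W k (\<lambda>l. rB l - fB l) *\<^sub>v ?b))
       = vec_norm2 (spectral_mat W k (\<lambda>l. rB l - fB l) *\<^sub>v ?b)"
      by (rule vec_norm2_isometry[OF Vc VV cB])
    also have "\<dots> \<le> E * vec_norm2 ?b"
    proof (rule spectral_mat_norm_le[OF W b'])
      fix l assume l: "l < k"
      show "cmod (rB l - fB l) \<le> E"
        using E[OF Xe[OF l] e[OF l]] by (simp add: rB_def fB_def \<tau>_def norm_minus_commute)
    qed
    also have "vec_norm2 (spectral_mat U n (\<lambda>l. fA l - rA l) *\<^sub>v b) \<le> E * vec_norm2 b"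
    proof (rule spectral_mat_norm_le[OF U b])
      fix l assume l: "l < n"
      show "cmod (fA l - rA l) \<le> E"
        using E[OF Xd[OF l] d[OF l]] by (simp add: rA_def fA_def \<sigma>_def)
    qed
    finally show "si_error t A b V \<le> 2 * E * vec_norm2 b" by (simp add: normb)
  qed
qed

section \<open>Rational approximation of the exponential\<close>

text \<open>The Cayley transform maps the upper half-plane onto the unit disc and the real line to the unit
  circle; with \<open>v = tan (\<phi> / 2)\<close> it sends \<open>v\<close> to \<open>exp (i \<phi>)\<close>.\<close>

definition cayley :: "complex \<Rightarrow> complex" where
  "cayley u = - (u - \<i>) / (u + \<i>)"

lemma of_real_pm_i_nonzero [simp]:
  "complex_of_real v + \<i> \<noteq> 0" "complex_of_real v - \<i> \<noteq> 0" "\<i> - complex_of_real v \<noteq> 0"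
  "\<i> \<noteq> complex_of_real v" "complex_of_real v \<noteq> \<i>"
  by (auto simp: complex_eq_iff)

lemma cayley_minus: "cayley (- complex_of_real v) = inverse (cayley (complex_of_real v))"
  by (simp add: cayley_def divide_simps)

lemma norm_cayley_real: "cmod (cayley (complex_of_real v)) = 1"
proof -
  have "cmod (\<i> - complex_of_real v) = cmod (complex_of_real v + \<i>)"
    by (simp add: cmod_def)
  thus ?thesis by (simp add: cayley_def norm_divide)
qed

text \<open>This is \<open>2 cos \<phi>\<close> expressed through \<open>cos\<^sup>2 (\<phi> / 2) = 1 / (1 + v\<^sup>2)\<close>, the quantity that is proportional to the
  resolvent when \<open>v\<^sup>2 = - x / q\<close>.\<close>

lemma cayley_add_inverse:
  "cayley (complex_of_real v) + inverse (cayley (complex_of_real v))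
    = complex_of_real (4 / (1 + v\<^sup>2) - 2)"
proof -
  have nz: "1 + v\<^sup>2 \<noteq> 0" by (smt (verit) zero_le_power2)
  hence nz': "1 + complex_of_real v * complex_of_real v \<noteq> 0"
    by (metis of_real_1 of_real_add of_real_eq_0_iff of_real_mult power2_eq_square)
  show ?thesis
    unfolding cayley_minus[symmetric] using nz' nz
    by (simp add: cayley_def divide_simps power2_eq_square) (simp add: algebra_simps)
qed

text \<open>The kernel \<open>K = (v + i) / ((u + i) (u - v))\<close>, which is \<open>1/(u - v) - 1/(u + i)\<close>, satisfies the recursion
  \<open>K = y (g + w(u) K)\<close> with \<open>y = 1 / w(v)\<close> and \<open>g = 2 i / (u + i)\<^sup>2\<close>. Iterating it is a finite geometric
  expansion. No term of the expansion is singular at \<open>u = i\<close>, so the line of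
  integration may pass through that point.\<close>

lemma cauchy_kernel_expansion:
  assumes u: "Im u > 0"
  shows "1 / (u - complex_of_real v) = 1 / (u + \<i>)
    + 2 * \<i> / (u + \<i>)\<^sup>2 * (\<Sum>k<m. cayley u ^ k * cayley (- complex_of_real v) ^ Suc k)
    + cayley u ^ m * cayley (- complex_of_real v) ^ m * ((v + \<i>) / ((u + \<i>) * (u - v)))"
proof -
  let ?v = "complex_of_real v"
  have nz: "u + \<i> \<noteq> 0" "u - ?v \<noteq> 0" using u by (auto simp: complex_eq_iff)
  define K g y where "K = (?v + \<i>) / ((u + \<i>) * (u - ?v))" and "g = 2 * \<i> / (u + \<i>)\<^sup>2"
    and "y = cayley (- ?v)"
  have rec: "K = y * (g + cayley u * K)"
    unfolding K_def g_def y_def using nz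
    by (simp add: cayley_def divide_simps power2_eq_square) (simp add: algebra_simps)
  have "1 / (u - ?v) = 1 / (u + \<i>) + g * (\<Sum>k<m. cayley u ^ k * y ^ Suc k) + cayley u ^ m * y ^ m * K"
  proof (induction m)
    case 0
    show ?case unfolding K_def using nz by (simp add: divide_simps)
  next
    case (Suc m)
    have "cayley u ^ m * y ^ m * K = cayley u ^ m * y ^ m * (y * (g + cayley u * K))"
      by (rule arg_cong[OF rec])
    also have "\<dots> = g * (cayley u ^ m * y ^ Suc m) + cayley u ^ Suc m * y ^ Suc m * K"
      by (simp add: algebra_simps)
    finally show ?case using Suc by (simp add: distrib_left)
  qed
  thus ?thesis by (simp only: K_def g_def y_def)
qed

text \<open>After clearing denominators this is the Cauchy-Schwarz inequality
  \<open>(x\<^sup>2 + c\<^sup>2) ((x - v)\<^sup>2 + c\<^sup>2) \<ge> c\<^sup>2 v\<^sup>2\<close>; the surplus of \<open>(1 + c)\<^sup>2\<close> over \<open>c\<^sup>2\<close> supplies the summand \<open>c\<^sup>2\<close>.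
  The bound is uniform in \<open>v\<close> and \<open>x\<close>, and so no power of \<open>m\<close> is lost to the tail of the geometric series.\<close>

lemma cauchy_kernel_remainder_le:
  assumes c: "c > 0"
  shows "cmod ((v + \<i>) / ((Complex x c + \<i>) * (Complex x c - complex_of_real v))) \<le> 1 / c"
proof -
  let ?u = "Complex x c"
  have nz: "?u + \<i> \<noteq> 0" "?u - complex_of_real v \<noteq> 0" using c by (auto simp: complex_eq_iff)
  have "(c * cmod (v + \<i>))\<^sup>2 = c\<^sup>2 * (v\<^sup>2 + 1)"
    by (simp add: power_mult_distrib cmod_power2)
  also have "\<dots> \<le> (x\<^sup>2 + (1 + c)\<^sup>2) * ((x - v)\<^sup>2 + c\<^sup>2)"
  proof -
    have "(x\<^sup>2 + (1 + c)\<^sup>2) * ((x - v)\<^sup>2 + c\<^sup>2) - c\<^sup>2 * (v\<^sup>2 + 1)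
       = (x * (v - x) - c\<^sup>2)\<^sup>2 + (1 + 2 * c) * (x - v)\<^sup>2 + 2 * c * c\<^sup>2"
      by (simp add: power2_eq_square algebra_simps)
    also have "\<dots> \<ge> 0" using c by (intro add_nonneg_nonneg mult_nonneg_nonneg) auto
    finally show ?thesis by simp
  qed
  also have "\<dots> = (cmod ((?u + \<i>) * (?u - complex_of_real v)))\<^sup>2"
    by (simp add: norm_mult power_mult_distrib cmod_power2 add.commute)
  finally have "c * cmod (v + \<i>) \<le> cmod ((?u + \<i>) * (?u - complex_of_real v))"
    by (rule power2_le_imp_le) simp
  thus ?thesis using c nz by (simp add: norm_divide divide_simps mult.commute)
qed

lemma contour_integral_horizontal:
  assumes "R > 0"
  shows "contour_integral (linepath (Complex (-R) c) (Complex R c)) f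
    = integral {-R..R} (\<lambda>x. f (Complex x c))"
proof -
  have "contour_integral (linepath (Complex (-R) c) (Complex R c)) f =
     (Complex R c - Complex (-R) c) * integral {0..1} (\<lambda>x. f (linepath (Complex (-R) c) (Complex R c) x))"
    by (simp add: contour_integral_integral)
  also have "Complex R c - Complex (-R) c = of_real (2 * R)"
    by (simp add: complex_eq_iff)
  also have "(\<lambda>x. f (linepath (Complex (-R) c) (Complex R c) x)) = (\<lambda>x. f (Complex (- R + 2 * R * x) c))"
    by (intro ext arg_cong[of _ _ f]) (simp add: linepath_def complex_eq_iff algebra_simps)
  also have "{0..1} = (\<lambda>x. x / (2 * R)) ` {0..2 * R}"
    using assms by simp
  also have "integral \<dots> (\<lambda>x. f (Complex (- R + 2 * R * x) c))
      = integral {0..2 * R} (\<lambda>x. f (Complex (x + - R) c)) / of_real (2 * R)"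
    using assms by (subst integral_stretch_real) (auto simp: scaleR_conv_of_real add_ac)
  also have "{0..2 * R} = {-R - (-R)..R - (-R)}" by simp
  also have "integral \<dots> (\<lambda>x. f (Complex (x + - R) c)) = integral {-R..R} (\<lambda>x. f (Complex x c))"
    by (subst integral_shift_real_ivl) (rule refl)
  finally show ?thesis using assms by simp
qed

lemma contour_integral_rectpath_split:
  assumes "continuous_on (path_image (rectpath (Complex a b) (Complex a' b'))) f" "a \<le> a'" "b \<le> b'"
  shows "contour_integral (rectpath (Complex a b) (Complex a' b')) f =
    contour_integral (linepath (Complex a b) (Complex a' b)) f
    + contour_integral (linepath (Complex a' b) (Complex a' b')) f
    - contour_integral (linepath (Complex a b') (Complex a' b')) f
    + contour_integral (linepath (Complex a b') (Complex a b)) f"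
proof -
  let ?p = "Complex a b" and ?q = "Complex a' b" and ?r = "Complex a' b'" and ?s = "Complex a b'"
  have im: "path_image (rectpath ?p ?r) = closed_segment ?p ?q \<union> closed_segment ?q ?r
      \<union> closed_segment ?r ?s \<union> closed_segment ?s ?p"
    by (simp add: rectpath_def Let_def path_image_join Un_assoc)
  have c: "f contour_integrable_on linepath ?p ?q" "f contour_integrable_on linepath ?q ?r"
      "f contour_integrable_on linepath ?r ?s" "f contour_integrable_on linepath ?s ?p"
    using assms(1) unfolding im
    by (auto intro!: contour_integrable_continuous_linepath elim: continuous_on_subset)
  have "contour_integral (linepath ?r ?s) f = - contour_integral (linepath ?s ?r) f"
    using assms(1) unfolding im
    by (intro contour_integral_reverse_linepath) (auto simp: closed_segment_commute elim: continuous_on_subset)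
  thus ?thesis
    using c by (simp add: rectpath_def Let_def)
qed

text \<open>Cauchy's formula on the rectangle \<open>|Re u| \<le> R\<close>, \<open>|Im u| \<le> c\<close>. Since the Gaussian is even, the reflection
  \<open>u \<mapsto> - u\<close> moves the lower side to the upper one and turns \<open>1/(u - v)\<close> into \<open>1/(u + v)\<close>; the right-hand
  side of the estimate bounds the two vertical sides.\<close>

lemma gaussian_cauchy_on_line:
  assumes c: "c > 0" and \<beta>: "\<beta> > 0" and v: "\<bar>v\<bar> < R"
  defines "f \<equiv> (\<lambda>u. exp (- (complex_of_real \<beta> * u\<^sup>2)))"
  shows "cmod (2 * pi * \<i> * f v + integral {-R..R}
      (\<lambda>x. f (Complex x c) * (1 / (Complex x c - v) + 1 / (Complex x c + v))))
    \<le> 4 * c * exp (\<beta> * (c\<^sup>2 - R\<^sup>2)) / (R - \<bar>v\<bar>)"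
proof -
  have R: "R > 0" using v by linarith
  let ?v = "complex_of_real v"
  define g where "g u = f u / (u - ?v)" for u
  let ?p = "Complex (-R) (-c)" and ?q = "Complex R (-c)" and ?r = "Complex R c" and ?s = "Complex (-R) c"
  have box: "?v \<in> box ?p ?r" using v c by (auto simp: in_box_complex_iff)
  have im: "path_image (rectpath ?p ?r) = cbox ?p ?r - box ?p ?r"
    using R c by (intro path_image_rectpath_cbox_minus_box) auto
  have holo: "f holomorphic_on UNIV" unfolding f_def by (intro holomorphic_intros)
  have "(g has_contour_integral (2 * pi * \<i> * winding_number (rectpath ?p ?r) ?v * f ?v)) (rectpath ?p ?r)"
    unfolding g_def
    by (rule Cauchy_integral_formula_convex_simple[of UNIV]) (use holo im box in auto)
  hence "contour_integral (rectpath ?p ?r) g = 2 * pi * \<i> * f ?v"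
    using winding_number_rectpath[OF box] by (simp add: contour_integral_unique)
  moreover have "continuous_on (path_image (rectpath ?p ?r)) g"
    unfolding g_def f_def using im box by (intro continuous_intros) auto
  ultimately have split: "2 * pi * \<i> * f ?v = contour_integral (linepath ?p ?q) g
      + contour_integral (linepath ?q ?r) g - contour_integral (linepath ?s ?r) g
      + contour_integral (linepath ?s ?p) g"
    using contour_integral_rectpath_split[of "-R" "-c" R c g] R c by simp
  have bottom: "contour_integral (linepath ?p ?q) g = integral {-R..R} (\<lambda>x. - (f (Complex x c) / (Complex x c + ?v)))"
  proof -
    have "contour_integral (linepath ?p ?q) g = integral {-R..R} (\<lambda>x. g (Complex x (-c)))"
      by (rule contour_integral_horizontal[OF R])
    also have "\<dots> = integral {-R..-(-R)} (\<lambda>x. g (Complex (-x) (-c)))"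
      using Henstock_Kurzweil_Integration.integral_reflect_real[of R "-R" "\<lambda>x. g (Complex x (-c))"] by simp
    also have "(\<lambda>x. g (Complex (-x) (-c))) = (\<lambda>x. - (f (Complex x c) / (Complex x c + ?v)))"
    proof
      fix x
      have e: "Complex (-x) (-c) = - Complex x c" by (simp add: complex_eq_iff)
      have "- Complex x c - ?v = - (Complex x c + ?v)" by simp
      thus "g (Complex (-x) (-c)) = - (f (Complex x c) / (Complex x c + ?v))"
        unfolding g_def e f_def by (simp only: minus_divide_right power2_minus)
    qed
    finally show ?thesis by simp
  qed
  have top: "contour_integral (linepath ?s ?r) g = integral {-R..R} (\<lambda>x. f (Complex x c) / (Complex x c - ?v))"
    unfolding contour_integral_horizontal[OF R] g_def ..
  have cont: "continuous_on {-R..R} (\<lambda>x. f (Complex x c) / (Complex x c - ?v))"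
    "continuous_on {-R..R} (\<lambda>x. f (Complex x c) / (Complex x c + ?v))"
    unfolding f_def Complex_eq using c by (intro continuous_intros; force simp: complex_eq_iff)+
  have "integral {-R..R} (\<lambda>x. f (Complex x c) * (1 / (Complex x c - v) + 1 / (Complex x c + v)))
     = contour_integral (linepath ?s ?r) g - contour_integral (linepath ?p ?q) g"
    unfolding top bottom
    by (subst integral_diff[symmetric])
      (use cont in \<open>auto intro!: integrable_continuous_real continuous_intros simp: algebra_simps\<close>)
  hence "2 * pi * \<i> * f v + integral {-R..R}
      (\<lambda>x. f (Complex x c) * (1 / (Complex x c - v) + 1 / (Complex x c + v)))
    = contour_integral (linepath ?q ?r) g + contour_integral (linepath ?s ?p) g"
    using split by simp
  moreover have side: "cmod (contour_integral (linepath a b) g) \<le> exp (\<beta> * (c\<^sup>2 - R\<^sup>2)) / (R - \<bar>v\<bar>) * cmod (b - a)"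
    if ab: "\<And>z. z \<in> closed_segment a b \<Longrightarrow> \<bar>Re z\<bar> = R \<and> \<bar>Im z\<bar> \<le> c" for a b
  proof (rule contour_integral_bound_linepath)
    show "g contour_integrable_on linepath a b"
      unfolding g_def f_def using ab v
      by (intro contour_integrable_continuous_linepath continuous_intros) force
    show "exp (\<beta> * (c\<^sup>2 - R\<^sup>2)) / (R - \<bar>v\<bar>) \<ge> 0" using v by simp
    fix z assume "z \<in> closed_segment a b"
    hence z: "\<bar>Re z\<bar> = R" "\<bar>Im z\<bar> \<le> c" using ab by auto
    have "(Re z)\<^sup>2 = R\<^sup>2" using z(1) by (metis power2_abs)
    moreover have "(Im z)\<^sup>2 \<le> c\<^sup>2" using z(2) c by (simp add: abs_le_square_iff[symmetric])
    ultimately have "\<beta> * ((Im z)\<^sup>2 - (Re z)\<^sup>2) \<le> \<beta> * (c\<^sup>2 - R\<^sup>2)"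
      using \<beta> by (intro mult_left_mono) auto
    moreover have "cmod (f z) = exp (\<beta> * ((Im z)\<^sup>2 - (Re z)\<^sup>2))"
      by (simp add: f_def power2_eq_square algebra_simps)
    ultimately have "cmod (f z) \<le> exp (\<beta> * (c\<^sup>2 - R\<^sup>2))" by simp
    moreover have "R - \<bar>v\<bar> \<le> cmod (z - ?v)"
      using abs_Re_le_cmod[of "z - ?v"] z(1) by simp
    ultimately show "cmod (g z) \<le> exp (\<beta> * (c\<^sup>2 - R\<^sup>2)) / (R - \<bar>v\<bar>)"
      unfolding g_def norm_divide using v by (intro frac_le) auto
  qed
  have s1: "cmod (contour_integral (linepath ?q ?r) g) \<le> exp (\<beta> * (c\<^sup>2 - R\<^sup>2)) / (R - \<bar>v\<bar>) * cmod (?r - ?q)"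
    using R c by (intro side) (auto simp: closed_segment_same_Re closed_segment_eq_real_ivl)
  have s2: "cmod (contour_integral (linepath ?s ?p) g) \<le> exp (\<beta> * (c\<^sup>2 - R\<^sup>2)) / (R - \<bar>v\<bar>) * cmod (?p - ?s)"
    using R c by (intro side) (auto simp: closed_segment_same_Re closed_segment_eq_real_ivl)
  have "?r - ?q = of_real (2 * c) * \<i>" "?p - ?s = - (of_real (2 * c) * \<i>)"
    by (simp_all add: complex_eq_iff)
  hence "cmod (?r - ?q) = 2 * c" "cmod (?p - ?s) = 2 * c"
    using c by (simp_all only: norm_minus_cancel norm_mult norm_of_real norm_ii)
  hence "cmod (contour_integral (linepath ?q ?r) g + contour_integral (linepath ?s ?p) g)
     \<le> exp (\<beta> * (c\<^sup>2 - R\<^sup>2)) / (R - \<bar>v\<bar>) * (2 * c) + exp (\<beta> * (c\<^sup>2 - R\<^sup>2)) / (R - \<bar>v\<bar>) * (2 * c)"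
    using s1 s2 by (intro norm_triangle_mono) auto
  ultimately show ?thesis by (simp add: algebra_simps)
qed

text \<open>These are the Chebyshev polynomials in the normalisation \<open>2 T\<^sub>n(s / 2)\<close>.\<close>

fun power_sum_poly :: "nat \<Rightarrow> complex poly" where
  "power_sum_poly 0 = [:2:]"
| "power_sum_poly (Suc 0) = [:0, 1:]"
| "power_sum_poly (Suc (Suc n)) = [:0, 1:] * power_sum_poly (Suc n) - power_sum_poly n"

lemma poly_power_sum_poly:
  assumes "y \<noteq> 0"
  shows "poly (power_sum_poly n) (y + inverse y) = y ^ n + inverse y ^ n"
  by (induction n rule: power_sum_poly.induct) (use assms in \<open>auto simp: field_simps\<close>)

lemma degree_power_sum_poly: "degree (power_sum_poly n) \<le> n"
proof (induction n rule: power_sum_poly.induct)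
  case (3 n)
  have "degree ([:0, 1:] * power_sum_poly (Suc n)) \<le> Suc (Suc n)"
    using degree_mult_le[of "[:0, 1:]" "power_sum_poly (Suc n)"] 3 by simp
  moreover have "degree (power_sum_poly n) \<le> Suc (Suc n)" using 3 by simp
  ultimately show ?case unfolding power_sum_poly.simps by (rule degree_diff_le)
qed auto

lemma cauchy_kernel_pair_expansion:
  fixes c x v :: real
  assumes c: "c > 0"
  defines "u \<equiv> Complex x c" and "y \<equiv> cayley (complex_of_real v)"
  shows "cmod (1 / (u - v) + 1 / (u + v) - (2 / (u + \<i>)
    + (\<Sum>k<m. 2 * \<i> / (u + \<i>)\<^sup>2 * cayley u ^ k * (y ^ Suc k + inverse y ^ Suc k))))
    \<le> 2 / c * cmod (cayley u) ^ m"
proof -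
  let ?v = "complex_of_real v"
  have u: "Im u > 0" using c by (simp add: u_def)
  have ny: "cmod y = 1" unfolding y_def by (rule norm_cayley_real)
  define K where "K v = (complex_of_real v + \<i>) / ((u + \<i>) * (u - complex_of_real v))" for v
  have K: "cmod (K v) \<le> 1 / c" for v unfolding K_def u_def by (rule cauchy_kernel_remainder_le[OF c])
  have K': "cmod (cayley u) ^ m * cmod (K v) \<le> cmod (cayley u) ^ m / c" for v
    using mult_left_mono[OF K[of v], of "cmod (cayley u) ^ m"] by simp
  define g where "g = 2 * \<i> / (u + \<i>)\<^sup>2"
  have e1: "1 / (u - ?v) = 1 / (u + \<i>) + g * (\<Sum>k<m. cayley u ^ k * inverse y ^ Suc k)
      + cayley u ^ m * inverse y ^ m * K v"
    using cauchy_kernel_expansion[OF u, of v m] by (simp only: cayley_minus K_def g_def y_def)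
  have "cayley (- complex_of_real (- v)) = y" by (simp add: y_def)
  hence e2: "1 / (u + ?v) = 1 / (u + \<i>) + g * (\<Sum>k<m. cayley u ^ k * y ^ Suc k)
      + cayley u ^ m * y ^ m * K (-v)"
    using cauchy_kernel_expansion[OF u, of "-v" m] by (simp add: K_def g_def)
  have sum: "(\<Sum>k<m. 2 * \<i> / (u + \<i>)\<^sup>2 * cayley u ^ k * (y ^ Suc k + inverse y ^ Suc k))
     = g * (\<Sum>k<m. cayley u ^ k * inverse y ^ Suc k) + g * (\<Sum>k<m. cayley u ^ k * y ^ Suc k)"
    unfolding g_def[symmetric] sum_distrib_left sum.distrib[symmetric]
    by (intro sum.cong refl) (simp only: algebra_simps)
  have "1 / (u - v) + 1 / (u + v) - (2 / (u + \<i>)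
    + (\<Sum>k<m. 2 * \<i> / (u + \<i>)\<^sup>2 * cayley u ^ k * (y ^ Suc k + inverse y ^ Suc k)))
    = cayley u ^ m * inverse y ^ m * K v + cayley u ^ m * y ^ m * K (-v)"
    unfolding sum e1 e2 by simp
  moreover have "cmod (cayley u ^ m * inverse y ^ m * K v + cayley u ^ m * y ^ m * K (-v))
     \<le> cmod (cayley u) ^ m * (1 / c) + cmod (cayley u) ^ m * (1 / c)"
    by (intro norm_triangle_mono)
      (use ny in \<open>simp_all add: norm_mult norm_power norm_inverse K'\<close>)
  ultimately show ?thesis by simp
qed

text \<open>Integrating the truncated kernel expansion against the Gaussian over \<open>[-R, R]\<close> gives a polynomial in
  the resolvent. The truncation costs \<open>B / (\<pi> c)\<close>, and \<open>\<delta>\<close> absorbs the vertical sides of the rectangle,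
  which vanish as \<open>R\<close> grows because \<open>v\<close> stays in a bounded interval.\<close>

lemma rational_approximation:
  assumes \<beta>: "\<beta> > 0" and c: "c > 0" and q: "q > 0" and \<delta>: "\<delta> > 0" and X: "X \<ge> 0"
    and B: "\<And>R. R > 0 \<Longrightarrow>
      integral {-R..R} (\<lambda>x. exp (\<beta> * (c\<^sup>2 - x\<^sup>2)) * cmod (cayley (Complex x c)) ^ m) \<le> B"
  obtains a where "\<And>x. -X \<le> x \<Longrightarrow> x \<le> 0 \<Longrightarrow>
    cmod (complex_of_real (exp (\<beta> / q * x)) - (\<Sum>j\<le>m. a j * complex_of_real (1 / (q - x)) ^ j))
      \<le> B / (pi * c) + \<delta>"
proof -
  define V where "V = sqrt (X / q)"
  have V: "V \<ge> 0" using X q by (simp add: V_def)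
  have "((\<lambda>R. 4 * c * exp (\<beta> * (c\<^sup>2 - R\<^sup>2))) \<longlongrightarrow> 0) at_top"
    using \<beta> by real_asymp
  moreover have "2 * pi * \<delta> > 0" using \<delta> by simp
  ultimately have "\<forall>\<^sub>F R in at_top. 4 * c * exp (\<beta> * (c\<^sup>2 - R\<^sup>2)) < 2 * pi * \<delta>"
    by (rule order_tendstoD(2))
  moreover have "\<forall>\<^sub>F R in at_top. R \<ge> V + 1" by (rule eventually_ge_at_top)
  ultimately have "\<forall>\<^sub>F R in at_top. 4 * c * exp (\<beta> * (c\<^sup>2 - R\<^sup>2)) < 2 * pi * \<delta> \<and> R \<ge> V + 1"
    by (rule eventually_conj)
  then obtain R where R: "4 * c * exp (\<beta> * (c\<^sup>2 - R\<^sup>2)) < 2 * pi * \<delta>" "R \<ge> V + 1"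
    by (auto dest!: eventually_happens)
  hence R0: "R > 0" using V by linarith
  define f where "f u = exp (- (complex_of_real \<beta> * u\<^sup>2))" for u
  define u where "u x = Complex x c" for x
  have nz: "u x + \<i> \<noteq> 0" for x using c by (auto simp: u_def complex_eq_iff)
  have cu [continuous_intros]: "continuous_on A u" for A
    unfolding u_def Complex_eq by (intro continuous_intros)
  define I where "I h = integral {-R..R} (\<lambda>x. f (u x) * h x)" for h :: "real \<Rightarrow> complex"
  \<comment> \<open>The sign is negative because the boundary runs along the upper side from right to left.\<close>
  define s where "s = (-1) / (2 * pi * \<i>)"
  define d0 where "d0 = s * I (\<lambda>x. 2 / (u x + \<i>))"
  define d where "d k = s * I (\<lambda>x. 2 * \<i> / (u x + \<i>)\<^sup>2 * cayley (u x) ^ k)" for k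
  define p where "p = [:d0:] + (\<Sum>k<m. Polynomial.smult (d k) (pcompose (power_sum_poly (Suc k)) [:-2, 4 * complex_of_real q:]))"
  have deg: "degree p \<le> m"
    unfolding p_def
  proof (intro degree_add_le degree_sum_le)
    fix k assume "k \<in> {..<m}"
    have "degree (pcompose (power_sum_poly (Suc k)) [:-2, 4 * complex_of_real q:]) \<le> Suc k"
      using degree_power_sum_poly[of "Suc k"] q by (simp add: degree_pcompose)
    thus "degree (Polynomial.smult (d k) (pcompose (power_sum_poly (Suc k)) [:-2, 4 * complex_of_real q:])) \<le> m"
      using \<open>k \<in> {..<m}\<close> Polynomial.degree_smult_le[of "d k"] by (meson lessThan_iff Suc_leI order_trans)
  qed auto
  have cf: "continuous_on A (\<lambda>x. f (u x))" for A
    unfolding f_def by (intro continuous_intros)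
  have cc: "continuous_on A (\<lambda>x. cayley (u x))" for A
    unfolding cayley_def using nz by (intro continuous_intros) auto
  have int: "(\<lambda>x. f (u x) * h x) integrable_on {-R..R}" if "continuous_on {-R..R} h" for h
    by (intro integrable_continuous_real continuous_on_mult cf that)
  show ?thesis
  proof (rule that[of "coeff p"])
    fix x assume x: "-X \<le> x" "x \<le> 0"
    define v where "v = sqrt (- x / q)"
    have v2: "v\<^sup>2 = - x / q" using x q by (simp add: v_def divide_nonpos_pos)
    have v0: "v \<ge> 0" using x q by (simp add: v_def divide_nonpos_pos)
    have vV: "v \<le> V" unfolding v_def V_def using x q by (intro real_sqrt_le_mono divide_right_mono) auto
    have vR: "\<bar>v\<bar> < R" using vV v0 R(2) by linarith
    define y where "y = cayley (complex_of_real v)"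
    have y0: "y \<noteq> 0" using norm_cayley_real[of v] by (auto simp: y_def)
    have fv: "f (complex_of_real v) = complex_of_real (exp (\<beta> / q * x))"
    proof -
      have "\<beta> / q * x = - (\<beta> * v\<^sup>2)" using q by (simp add: v2)
      thus ?thesis by (simp add: f_def exp_of_real[symmetric])
    qed
    have yq: "y + inverse y = poly [:-2, 4 * complex_of_real q:] (complex_of_real (1 / (q - x)))"
    proof -
      have "4 / (1 + v\<^sup>2) - 2 = - 2 + 4 * q * (1 / (q - x))"
        unfolding v2 using q x by (simp add: field_simps)
      thus ?thesis unfolding y_def cayley_add_inverse
        by (simp del: of_real_divide) (simp add: mult_ac)
    qed
    define hs where "hs k x = 2 * \<i> / (u x + \<i>)\<^sup>2 * cayley (u x) ^ k * (y ^ Suc k + inverse y ^ Suc k)" for k x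
    have chs: "continuous_on {-R..R} (hs k)" for k
      unfolding hs_def using nz by (intro continuous_intros cc) auto
    have ch0: "continuous_on {-R..R} (\<lambda>x. 2 / (u x + \<i>))"
      using nz by (intro continuous_intros) auto
    have "poly p (complex_of_real (1 / (q - x))) = d0 + (\<Sum>k<m. d k * (y ^ Suc k + inverse y ^ Suc k))"
      unfolding p_def using yq poly_power_sum_poly[OF y0]
      by (simp add: poly_sum poly_pcompose del: power_sum_poly.simps power_Suc)
    also have "\<dots> = s * (I (\<lambda>x. 2 / (u x + \<i>)) + (\<Sum>k<m. I (hs k)))"
    proof -
      have "I (\<lambda>x. 2 * \<i> / (u x + \<i>)\<^sup>2 * cayley (u x) ^ k) * (y ^ Suc k + inverse y ^ Suc k) = I (hs k)" for k
        unfolding I_def hs_def integral_mult_left[symmetric] by (simp only: mult.assoc)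
      thus ?thesis unfolding d0_def d_def
        by (simp only: distrib_left[of s] sum_distrib_left mult.assoc)
    qed
    also have "(\<Sum>k<m. I (hs k)) = I (\<lambda>x. \<Sum>k<m. hs k x)"
      unfolding I_def sum_distrib_left
      by (subst integral_sum) (auto intro!: int chs)
    also have "I (\<lambda>x. 2 / (u x + \<i>)) + I (\<lambda>x. \<Sum>k<m. hs k x) = I (\<lambda>x. 2 / (u x + \<i>) + (\<Sum>k<m. hs k x))"
      unfolding I_def distrib_left
      by (rule integral_add[symmetric]) (intro int ch0 chs continuous_on_sum)+
    finally have pv: "poly p (complex_of_real (1 / (q - x))) = s * I (\<lambda>x. 2 / (u x + \<i>) + (\<Sum>k<m. hs k x))" .
    define k1 where "k1 x = 1 / (u x - v) + 1 / (u x + v)" for x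
    define k2 where "k2 x = 2 / (u x + \<i>) + (\<Sum>k<m. hs k x)" for x
    have c1: "continuous_on {-R..R} k1"
      unfolding k1_def using c by (intro continuous_intros) (auto simp: u_def complex_eq_iff)
    have c2: "continuous_on {-R..R} k2"
      unfolding k2_def by (intro continuous_on_add continuous_on_sum ch0 chs)
    have main: "cmod (2 * pi * \<i> * f v + I k1) \<le> 2 * pi * \<delta>"
    proof -
      have "cmod (2 * pi * \<i> * f v + I k1) \<le> 4 * c * exp (\<beta> * (c\<^sup>2 - R\<^sup>2)) / (R - \<bar>v\<bar>)"
        unfolding I_def k1_def f_def u_def by (rule gaussian_cauchy_on_line[OF c \<beta> vR])
      also have "\<dots> \<le> 4 * c * exp (\<beta> * (c\<^sup>2 - R\<^sup>2)) / 1"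
        using vV v0 R(2) c by (intro divide_left_mono) auto
      finally show ?thesis using R(1) by simp
    qed
    have diff: "cmod (I k1 - I k2) \<le> 2 / c * B"
    proof -
      let ?h = "\<lambda>x. exp (\<beta> * (c\<^sup>2 - x\<^sup>2)) * cmod (cayley (Complex x c)) ^ m"
      have "I k1 - I k2 = integral {-R..R} (\<lambda>x. f (u x) * k1 x - f (u x) * k2 x)"
        unfolding I_def by (rule integral_diff[symmetric]) (intro int c1 c2)+
      also have "cmod \<dots> \<le> integral {-R..R} (\<lambda>x. 2 / c * ?h x)"
      proof (rule integral_norm_bound_integral)
        show "(\<lambda>x. f (u x) * k1 x - f (u x) * k2 x) integrable_on {-R..R}"
          by (intro integrable_diff int c1 c2)
        show "(\<lambda>x. 2 / c * ?h x) integrable_on {-R..R}"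
          using cc by (intro integrable_continuous_real continuous_intros) (simp add: u_def)
        fix x
        have "cmod (k1 x - k2 x) \<le> 2 / c * cmod (cayley (u x)) ^ m"
          unfolding k1_def k2_def hs_def u_def y_def by (rule cauchy_kernel_pair_expansion[OF c])
        moreover have "cmod (f (u x)) = exp (\<beta> * (c\<^sup>2 - x\<^sup>2))"
          by (simp add: f_def u_def power2_eq_square algebra_simps)
        ultimately have "cmod (f (u x)) * cmod (k1 x - k2 x)
            \<le> exp (\<beta> * (c\<^sup>2 - x\<^sup>2)) * (2 / c * cmod (cayley (u x)) ^ m)"
          by (intro mult_mono) auto
        thus "cmod (f (u x) * k1 x - f (u x) * k2 x) \<le> 2 / c * ?h x"
          unfolding right_diff_distrib[symmetric] norm_mult by (simp add: u_def mult_ac)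
      qed
      also have "\<dots> = 2 / c * integral {-R..R} ?h" by simp
      also have "\<dots> \<le> 2 / c * B" using c by (intro mult_left_mono B R0) auto
      finally show ?thesis .
    qed
    define T where "T = f v - poly p (complex_of_real (1 / (q - x)))"
    have s1: "2 * pi * \<i> * s = -1" by (simp add: s_def)
    have "2 * pi * \<i> * T = 2 * pi * \<i> * f v - (2 * pi * \<i> * s) * I k2"
      unfolding T_def pv k2_def[symmetric] by (simp only: right_diff_distrib mult.assoc)
    also have "\<dots> = (2 * pi * \<i> * f v + I k1) - (I k1 - I k2)"
      unfolding s1 by simp
    finally have "cmod (2 * pi * \<i> * T) \<le> 2 * pi * \<delta> + 2 / c * B"
      using norm_triangle_ineq4[of "2 * pi * \<i> * f v + I k1" "I k1 - I k2"] main diff by simp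
    moreover have "cmod (2 * pi * \<i> * T) = 2 * pi * cmod T"
      by (simp add: norm_mult)
    ultimately have "2 * pi * cmod T \<le> 2 * pi * \<delta> + 2 / c * B" by simp
    hence "cmod (f v - poly p (complex_of_real (1 / (q - x)))) \<le> B / (pi * c) + \<delta>"
      unfolding T_def[symmetric] using c by (simp add: field_simps)
    moreover have "poly p z = (\<Sum>j\<le>m. coeff p j * z ^ j)" for z
      using arg_cong[OF poly_as_sum_of_monoms'[OF deg], of "\<lambda>r. poly r z"] by (simp add: poly_sum poly_monom)
    ultimately show "cmod (complex_of_real (exp (\<beta> / q * x))
        - (\<Sum>j\<le>m. coeff p j * complex_of_real (1 / (q - x)) ^ j)) \<le> B / (pi * c) + \<delta>"
      unfolding fv by simp
  qed
qed

section \<open>The integrand on the saddle line\<close>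

text \<open>The value of \<open>H_e\<close> at \<open>\<alpha> = 1 / (r (r\<^sup>2 - 1))\<close>, see \<open>H_e_saddle\<close> below. The parameter \<open>r\<close> makes it an
  elementary function, whereas \<open>\<zeta>\<^sub>\<alpha>\<close> is only given implicitly.\<close>

definition saddle_rate :: "real \<Rightarrow> real" where
  "saddle_rate r = sqrt ((r - 1) / (r + 1)) * exp ((2 - r\<^sup>2) / (2 * r * (r\<^sup>2 - 1)))"

text \<open>A lower bound for the rate at which the logarithm of the integrand falls off quadratically away from
  the saddles \<open>\<plusminus> sqrt (3 r\<^sup>2 / 4 - 1) + i r / 2\<close>.\<close>

definition saddle_curvature :: "real \<Rightarrow> real" where
  "saddle_curvature r = min 1 ((3 * r\<^sup>2 / 4 - 1) / (1 + r / 2)\<^sup>2) / (r * (r\<^sup>2 - 1))"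

text \<open>The cubic \<open>\<alpha> (\<zeta>\<^sup>3 - \<zeta>) + 1\<close> has a pair of non-real roots exactly when \<open>\<alpha> < alpha_c\<close>, that is when
  \<open>r > 2 / sqrt 3\<close>.\<close>

lemma saddle_range:
  assumes "r > 2 / sqrt 3"
  shows "r > 1" "3 * r\<^sup>2 / 4 - 1 > 0" "r * (r\<^sup>2 - 1) > 0"
proof -
  have "r\<^sup>2 > (2 / sqrt 3)\<^sup>2"
    using assms by (intro power_strict_mono) auto
  hence r2: "r\<^sup>2 > 4 / 3" by (simp add: power_divide)
  have r0: "r > 0" using assms less_trans[of 0 "2 / sqrt 3" r] by simp
  show "3 * r\<^sup>2 / 4 - 1 > 0" using r2 by simp
  have "1\<^sup>2 < r\<^sup>2" using r2 by simp
  thus "r > 1" using r0 by (intro power_less_imp_less_base[of 1 2 r]) auto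
  show "r * (r\<^sup>2 - 1) > 0" using r0 r2 by (intro mult_pos_pos) auto
qed

lemma saddle_rate_pos: "r > 1 \<Longrightarrow> saddle_rate r > 0"
  by (simp add: saddle_rate_def)

lemma saddle_curvature_pos: "r > 2 / sqrt 3 \<Longrightarrow> saddle_curvature r > 0"
  using saddle_range[of r] by (simp add: saddle_curvature_def)

lemma norm_cayley_line:
  "(cmod (cayley (Complex x c)))\<^sup>2 = ((1 - c)\<^sup>2 + x\<^sup>2) / ((1 + c)\<^sup>2 + x\<^sup>2)"
proof -
  have "(cmod (\<i> - Complex x c))\<^sup>2 = (1 - c)\<^sup>2 + x\<^sup>2" "(cmod (Complex x c + \<i>))\<^sup>2 = (1 + c)\<^sup>2 + x\<^sup>2"
    unfolding cmod_power2 by (simp_all add: power2_eq_square algebra_simps)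
  thus ?thesis by (simp add: cayley_def norm_divide power_divide)
qed

text \<open>On the line the logarithm of the square of the left-hand side depends only on \<open>y = x\<^sup>2\<close>: it is
  \<open>2 \<alpha> ((r/2)\<^sup>2 - y) + log N(y)\<close> with \<open>N(y) = (a + y) / (b + y)\<close>. Write \<open>N(y) = N(y0) (1 + s)\<close>, where \<open>y0\<close> belongs to
  the saddle, and use \<open>1 + s \<le> exp s\<close>. As \<open>y0\<close> is a critical point, the terms of first order in \<open>y - y0\<close> in
  the exponent cancel, and what is left is exactly \<open>- 2 \<alpha> (y - y0)\<^sup>2 / (b + y)\<close>: an inequality without
  error terms, valid on the whole line.\<close>

lemma integrand_le_on_saddle_line:
  assumes r: "r > 2 / sqrt 3"
  defines "\<alpha> \<equiv> 1 / (r * (r\<^sup>2 - 1))" and "x0 \<equiv> sqrt (3 * r\<^sup>2 / 4 - 1)"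
  shows "exp (\<alpha> * ((r / 2)\<^sup>2 - x\<^sup>2)) * cmod (cayley (Complex x (r / 2)))
    \<le> saddle_rate r * exp (- saddle_curvature r * (\<bar>x\<bar> - x0)\<^sup>2)"
proof -
  note range = saddle_range[OF r]
  have r1: "r > 1" using range by simp
  have \<alpha>: "\<alpha> > 0" using range by (simp add: \<alpha>_def)
  define y y0 where "y = x\<^sup>2" and "y0 = 3 * r\<^sup>2 / 4 - 1"
  define a b where "a = (1 - r / 2)\<^sup>2" and "b = (1 + r / 2)\<^sup>2"
  have y: "y \<ge> 0" "y0 > 0" using range by (simp_all add: y_def y0_def)
  have b: "b > 0" using r1 by (simp add: b_def)
  have ay: "a + y0 = r * (r - 1)" and bY: "b + y0 = r * (r + 1)"
    by (simp_all add: a_def b_def y0_def power2_eq_square field_simps)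
  have ba: "b - a = 2 * r" by (simp add: a_def b_def power2_eq_square field_simps)
  have x0: "x0 \<ge> 0" "x0\<^sup>2 = y0" using y by (simp_all add: x0_def y0_def)
  have a0: "a + y0 > 0" "b + y0 > 0" "b + y > 0" using ay bY b y r1 by auto
  define s where "s = (a + y) * (b + y0) / ((b + y) * (a + y0)) - 1"
  have "s = (y - y0) * (b - a) / ((b + y) * (a + y0))"
  proof -
    have "(a + y) * (b + y0) - (b + y) * (a + y0) = (y - y0) * (b - a)"
      by (simp add: algebra_simps)
    thus ?thesis unfolding s_def using a0 by (simp add: diff_divide_distrib[symmetric] divide_simps)
  qed
  also have "\<dots> = (y - y0) / (b + y) * ((b - a) / (a + y0))" by simp
  also have "(b - a) / (a + y0) = 2 * \<alpha> * (b + y0)"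
  proof -
    have "r\<^sup>2 - 1 = (r - 1) * (r + 1)" by (simp add: power2_eq_square algebra_simps)
    thus ?thesis unfolding ba ay bY \<alpha>_def using r1 by (simp add: divide_simps)
  qed
  also have "(y - y0) / (b + y) * (2 * \<alpha> * (b + y0)) = 2 * \<alpha> * (y - y0) * ((b + y0) / (b + y))" by simp
  also have "(b + y0) / (b + y) = 1 - (y - y0) / (b + y)"
    using a0 by (simp add: divide_simps)
  finally have s_eq: "s = 2 * \<alpha> * (y - y0) * (1 - (y - y0) / (b + y))" .
  have s: "s - 2 * \<alpha> * (y - y0) = - 2 * (\<alpha> * (y - y0)\<^sup>2 / (b + y))"
  proof -
    have "2 * \<alpha> * z * (1 - z / w) - 2 * \<alpha> * z = - 2 * (\<alpha> * z\<^sup>2 / w)" for z w :: real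
      by (simp add: right_diff_distrib power2_eq_square)
    thus ?thesis unfolding s_eq .
  qed
  have curv: "saddle_curvature r * (\<bar>x\<bar> - x0)\<^sup>2 \<le> \<alpha> * (y - y0)\<^sup>2 / (b + y)"
  proof -
    have "(y - y0)\<^sup>2 = (\<bar>x\<bar> - x0)\<^sup>2 * (\<bar>x\<bar> + x0)\<^sup>2"
    proof -
      have "y - y0 = \<bar>x\<bar>\<^sup>2 - x0\<^sup>2" using x0(2) by (simp add: y_def)
      also have "\<dots> = (\<bar>x\<bar> - x0) * (\<bar>x\<bar> + x0)"
        by (simp only: power2_eq_square square_diff_square_factored mult.commute)
      finally show ?thesis by (simp only: power_mult_distrib)
    qed
    moreover have "min 1 (y0 / b) * (b + y) \<le> (\<bar>x\<bar> + x0)\<^sup>2"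
    proof -
      have "min 1 (y0 / b) * b \<le> y0" "min 1 (y0 / b) * y \<le> y"
        using mult_right_mono[OF min.cobounded2[of 1 "y0 / b"], of b] b
          mult_right_mono[OF min.cobounded1[of 1 "y0 / b"], of y] y by simp_all
      hence "min 1 (y0 / b) * (b + y) \<le> y0 + y" by (simp add: distrib_left)
      also have "\<dots> \<le> (\<bar>x\<bar> + x0)\<^sup>2"
        using x0 by (simp add: power2_sum y_def)
      finally show ?thesis .
    qed
    ultimately have "min 1 (y0 / b) * (b + y) * (\<bar>x\<bar> - x0)\<^sup>2 \<le> (y - y0)\<^sup>2"
      by (simp add: mult.commute mult_left_mono)
    hence "min 1 (y0 / b) * (\<bar>x\<bar> - x0)\<^sup>2 \<le> (y - y0)\<^sup>2 / (b + y)"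
      using a0 by (simp add: field_simps)
    hence "\<alpha> * (min 1 (y0 / b) * (\<bar>x\<bar> - x0)\<^sup>2) \<le> \<alpha> * ((y - y0)\<^sup>2 / (b + y))"
      using \<alpha> by (intro mult_left_mono) auto
    thus ?thesis by (simp add: saddle_curvature_def \<alpha>_def y0_def b_def)
  qed
  have rate: "(saddle_rate r)\<^sup>2 = (a + y0) / (b + y0) * exp (2 * \<alpha> * ((r / 2)\<^sup>2 - y0))"
  proof -
    have "(saddle_rate r)\<^sup>2 = (r - 1) / (r + 1) * (exp ((2 - r\<^sup>2) / (2 * r * (r\<^sup>2 - 1))))\<^sup>2"
      using r1 by (simp add: saddle_rate_def power_mult_distrib)
    also have "(exp ((2 - r\<^sup>2) / (2 * r * (r\<^sup>2 - 1))))\<^sup>2 = exp (2 * ((2 - r\<^sup>2) / (2 * r * (r\<^sup>2 - 1))))"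
      by (simp only: exp_double)
    also have "2 * ((2 - r\<^sup>2) / (2 * r * (r\<^sup>2 - 1))) = 2 * \<alpha> * ((r / 2)\<^sup>2 - y0)"
    proof -
      have h: "(r / 2)\<^sup>2 - y0 = (2 - r\<^sup>2) / 2" by (simp add: y0_def power_divide field_simps)
      have "2 * (P / (2 * r * Q)) = 2 * (1 / (r * Q)) * (P / 2)" for P Q :: real by simp
      thus ?thesis unfolding h \<alpha>_def .
    qed
    also have "(r - 1) / (r + 1) = (a + y0) / (b + y0)"
      unfolding ay bY using r1 by simp
    finally show ?thesis .
  qed
  have "(exp (\<alpha> * ((r / 2)\<^sup>2 - x\<^sup>2)) * cmod (cayley (Complex x (r / 2))))\<^sup>2
      = exp (2 * \<alpha> * ((r / 2)\<^sup>2 - y)) * ((a + y) / (b + y))"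
    unfolding power_mult_distrib norm_cayley_line
    by (simp add: exp_double[symmetric] a_def b_def y_def mult.assoc)
  also have "(a + y) / (b + y) = (a + y0) / (b + y0) * (1 + s)"
  proof -
    have "1 + s = (a + y) * (b + y0) / ((b + y) * (a + y0))" by (simp add: s_def)
    moreover have "P / S = T / Q * (P * Q / (S * T))" if "Q > 0" "T > 0" for P Q S T :: real
      using that by simp
    ultimately show ?thesis using a0 by metis
  qed
  also have "exp (2 * \<alpha> * ((r / 2)\<^sup>2 - y)) * ((a + y0) / (b + y0) * (1 + s))
      \<le> exp (2 * \<alpha> * ((r / 2)\<^sup>2 - y)) * ((a + y0) / (b + y0) * exp s)"
    using a0 by (intro mult_left_mono exp_ge_add_one_self) auto
  also have "\<dots> = (saddle_rate r)\<^sup>2 * exp (s - 2 * \<alpha> * (y - y0))"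
  proof -
    have "exp (2 * \<alpha> * ((r / 2)\<^sup>2 - y)) * exp s
        = exp (2 * \<alpha> * ((r / 2)\<^sup>2 - y0)) * exp (s - 2 * \<alpha> * (y - y0))"
      unfolding exp_add[symmetric] by (simp add: algebra_simps)
    thus ?thesis unfolding rate by (simp only: mult.assoc mult.left_commute)
  qed
  also have "\<dots> = (saddle_rate r * exp (- (\<alpha> * (y - y0)\<^sup>2 / (b + y))))\<^sup>2"
    unfolding s power_mult_distrib by (simp only: exp_double[symmetric] mult_minus_right mult_minus_left)
  finally have "(exp (\<alpha> * ((r / 2)\<^sup>2 - x\<^sup>2)) * cmod (cayley (Complex x (r / 2))))\<^sup>2
      \<le> (saddle_rate r * exp (- (\<alpha> * (y - y0)\<^sup>2 / (b + y))))\<^sup>2" .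
  hence "exp (\<alpha> * ((r / 2)\<^sup>2 - x\<^sup>2)) * cmod (cayley (Complex x (r / 2)))
      \<le> saddle_rate r * exp (- (\<alpha> * (y - y0)\<^sup>2 / (b + y)))"
    by (rule power2_le_imp_le) (intro mult_nonneg_nonneg less_imp_le[OF saddle_rate_pos[OF r1]] exp_ge_zero)
  also have "\<dots> \<le> saddle_rate r * exp (- saddle_curvature r * (\<bar>x\<bar> - x0)\<^sup>2)"
    using curv saddle_rate_pos[OF r1] by (intro mult_left_mono) auto
  finally show ?thesis .
qed

text \<open>A substitute for the Gaussian integral with the same dependence on \<open>K\<close>: \<open>exp (- z) \<le> 1 / (1 + z)\<close>, and the
  right-hand side has the arctangent as primitive.\<close>

lemma integral_cauchy_density_le:
  assumes K: "K > 0" and R: "R > 0"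
  shows "integral {-R..R} (\<lambda>x. 1 / (1 + K * (x - p)\<^sup>2)) \<le> pi / sqrt K"
proof -
  let ?F = "\<lambda>x. arctan (sqrt K * (x - p)) / sqrt K"
  have "((\<lambda>x. 1 / (1 + K * (x - p)\<^sup>2)) has_integral (?F R - ?F (-R))) {-R..R}"
  proof (rule fundamental_theorem_of_calculus)
    fix x
    have "(?F has_real_derivative (inverse (1 + (sqrt K * (x - p))\<^sup>2) * (sqrt K * 1)) / sqrt K) (at x within {-R..R})"
      using K by (auto intro!: derivative_eq_intros simp: mult.assoc)
    also have "(inverse (1 + (sqrt K * (x - p))\<^sup>2) * (sqrt K * 1)) / sqrt K = 1 / (1 + K * (x - p)\<^sup>2)"
      using K by (simp add: power_mult_distrib inverse_eq_divide)
    finally show "(?F has_vector_derivative 1 / (1 + K * (x - p)\<^sup>2)) (at x within {-R..R})"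
      by (simp add: has_real_derivative_iff_has_vector_derivative)
  qed (use R in auto)
  hence "integral {-R..R} (\<lambda>x. 1 / (1 + K * (x - p)\<^sup>2)) = ?F R - ?F (-R)" by blast
  also have "\<dots> = (arctan (sqrt K * (R - p)) - arctan (sqrt K * (-R - p))) / sqrt K"
    by (simp add: diff_divide_distrib)
  also have "\<dots> \<le> (pi / 2 - (- pi / 2)) / sqrt K"
    using K arctan_ubound[of "sqrt K * (R - p)"] arctan_lbound[of "sqrt K * (-R - p)"]
    by (intro divide_right_mono) auto
  finally show ?thesis by simp
qed

lemma saddle_integral_le:
  assumes r: "r > 2 / sqrt 3" and m: "m \<ge> 1" and R: "R > 0"
  defines "\<alpha> \<equiv> 1 / (r * (r\<^sup>2 - 1))"
  shows "integral {-R..R} (\<lambda>x. exp (\<alpha> * real m * ((r / 2)\<^sup>2 - x\<^sup>2)) * cmod (cayley (Complex x (r / 2))) ^ m)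
    \<le> saddle_rate r ^ m * (2 * pi / sqrt (saddle_curvature r * real m))"
proof -
  define x0 where "x0 = sqrt (3 * r\<^sup>2 / 4 - 1)"
  define K where "K = saddle_curvature r * real m"
  have K: "K > 0" using saddle_curvature_pos[OF r] m by (simp add: K_def)
  have h0: "saddle_rate r \<ge> 0" using saddle_rate_pos saddle_range(1)[OF r] by (simp add: less_imp_le)
  let ?g = "\<lambda>p x. 1 / (1 + K * (x - p)\<^sup>2)"
  have pos: "1 + K * (x - p)\<^sup>2 > 0" for x p
    using K by (intro add_pos_nonneg) auto
  have contg: "(?g p) integrable_on {-R..R}" for p
    using pos by (intro integrable_continuous_real continuous_intros) (simp add: less_imp_neq[symmetric])
  have nz: "Complex x (r / 2) + \<i> \<noteq> 0" for x
    using saddle_range(1)[OF r] by (auto simp: complex_eq_iff)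
  have "integral {-R..R} (\<lambda>x. exp (\<alpha> * real m * ((r / 2)\<^sup>2 - x\<^sup>2)) * cmod (cayley (Complex x (r / 2))) ^ m)
      \<le> integral {-R..R} (\<lambda>x. saddle_rate r ^ m * (?g x0 x + ?g (- x0) x))"
  proof (rule integral_le)
    show "(\<lambda>x. exp (\<alpha> * real m * ((r / 2)\<^sup>2 - x\<^sup>2)) * cmod (cayley (Complex x (r / 2))) ^ m) integrable_on {-R..R}"
      using nz unfolding cayley_def Complex_eq
      by (intro integrable_continuous_real continuous_intros) auto
    show "(\<lambda>x. saddle_rate r ^ m * (?g x0 x + ?g (- x0) x)) integrable_on {-R..R}"
      using integrable_add[OF contg contg] by (rule integrable_on_mult_right)
    fix x
    have "exp (\<alpha> * real m * ((r / 2)\<^sup>2 - x\<^sup>2)) * cmod (cayley (Complex x (r / 2))) ^ m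
        = (exp (\<alpha> * ((r / 2)\<^sup>2 - x\<^sup>2)) * cmod (cayley (Complex x (r / 2)))) ^ m"
      by (simp add: power_mult_distrib exp_of_nat_mult[symmetric] mult_ac)
    also have "\<dots> \<le> (saddle_rate r * exp (- saddle_curvature r * (\<bar>x\<bar> - x0)\<^sup>2)) ^ m"
      unfolding \<alpha>_def x0_def by (intro power_mono integrand_le_on_saddle_line[OF r]) auto
    also have "\<dots> = saddle_rate r ^ m * exp (- (K * (\<bar>x\<bar> - x0)\<^sup>2))"
      by (simp add: power_mult_distrib exp_of_nat_mult[symmetric] K_def mult_ac)
    also have "exp (- (K * (\<bar>x\<bar> - x0)\<^sup>2)) \<le> ?g x0 x + ?g (- x0) x"
    proof -
      have "exp (- (K * z)) \<le> 1 / (1 + K * z)" if "z \<ge> 0" for z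
        using exp_ge_add_one_self[of "K * z"] K that
        by (simp add: exp_minus inverse_eq_divide divide_simps add_pos_nonneg)
      hence "exp (- (K * (\<bar>x\<bar> - x0)\<^sup>2)) \<le> 1 / (1 + K * (\<bar>x\<bar> - x0)\<^sup>2)" by simp
      also have "\<dots> \<le> ?g x0 x + ?g (- x0) x"
      proof (cases "x \<ge> 0")
        case True
        thus ?thesis using pos[of x "-x0"] by simp
      next
        case False
        hence "(\<bar>x\<bar> - x0)\<^sup>2 = (x - - x0)\<^sup>2" by (simp add: power2_eq_square algebra_simps)
        thus ?thesis using pos[of x x0] by simp
      qed
      finally show ?thesis .
    qed
    finally show "exp (\<alpha> * real m * ((r / 2)\<^sup>2 - x\<^sup>2)) * cmod (cayley (Complex x (r / 2))) ^ m
        \<le> saddle_rate r ^ m * (?g x0 x + ?g (- x0) x)"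
      using h0 by (simp add: mult_left_mono)
  qed
  also have "\<dots> = saddle_rate r ^ m * (integral {-R..R} (?g x0) + integral {-R..R} (?g (- x0)))"
    by (simp only: integral_mult_right integral_add[OF contg contg])
  also have "\<dots> \<le> saddle_rate r ^ m * (pi / sqrt K + pi / sqrt K)"
    using h0 by (intro mult_left_mono add_mono integral_cauchy_density_le K R) auto
  finally show ?thesis by (simp add: K_def)
qed

section \<open>The error bound at finite degree\<close>

text \<open>The contour runs through the saddles, \<open>c = r / 2\<close>. The approximation error is \<open>B / (\<pi> c)\<close> with
  \<open>B = 2 \<pi> H\<^sup>m / sqrt (\<kappa> m)\<close>, up to an arbitrarily small \<open>\<delta>\<close>; quasi-optimality doubles it, which gives the
  factor 8.\<close>

lemma si_error_bound:
  assumes t: "t > 0" and r: "r > 2 / sqrt 3" and m: "m \<ge> 1"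
    and q: "q = real m / (t * (r * (r\<^sup>2 - 1)))"
    and A: "hermitian_nsd n A" and b: "b \<in> carrier_vec n" and V: "si_basis A b q m V"
  shows "si_error t A b V
    \<le> 8 / (r * sqrt (saddle_curvature r)) / sqrt (real m) * saddle_rate r ^ m * vec_norm2 b"
proof -
  note range = saddle_range[OF r]
  define \<alpha> where "\<alpha> = 1 / (r * (r\<^sup>2 - 1))"
  have \<alpha>: "\<alpha> > 0" using range by (simp add: \<alpha>_def)
  have q0: "q > 0" unfolding q using m t range by simp
  have \<beta>: "\<alpha> * real m > 0" using \<alpha> m by simp
  have \<beta>q: "\<alpha> * real m / q = t" unfolding q \<alpha>_def using m t range by (simp add: field_simps)
  define B where "B = saddle_rate r ^ m * (2 * pi / sqrt (saddle_curvature r * real m))"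
  obtain X where X: "\<And>c E. (\<And>x. -X \<le> x \<Longrightarrow> x \<le> 0 \<Longrightarrow>
      cmod (complex_of_real (exp (t * x)) - (\<Sum>j\<le>m. c j * complex_of_real (1 / (q - x)) ^ j)) \<le> E)
    \<Longrightarrow> si_error t A b V \<le> 2 * E * vec_norm2 b"
    using si_error_quasi_optimal[OF A b q0 V] by blast
  have approx: "si_error t A b V \<le> 2 * (B / (pi * (r / 2)) + \<delta>) * vec_norm2 b" if \<delta>: "\<delta> > 0" for \<delta>
  proof -
    have c: "r / 2 > 0" using range by simp
    define X' where "X' = max X 0"
    have X': "X' \<ge> 0" "X \<le> X'" by (simp_all add: X'_def)
    have BR: "integral {-R..R} (\<lambda>x. exp (\<alpha> * real m * ((r / 2)\<^sup>2 - x\<^sup>2)) * cmod (cayley (Complex x (r / 2))) ^ m) \<le> B"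
      if "R > 0" for R
      unfolding B_def \<alpha>_def by (rule saddle_integral_le[OF r m that])
    obtain a where a: "\<And>x. - X' \<le> x \<Longrightarrow> x \<le> 0 \<Longrightarrow>
      cmod (complex_of_real (exp (\<alpha> * real m / q * x)) - (\<Sum>j\<le>m. a j * complex_of_real (1 / (q - x)) ^ j))
        \<le> B / (pi * (r / 2)) + \<delta>"
      using rational_approximation[OF \<beta> c q0 \<delta> X'(1) BR] by blast
    show ?thesis
      by (rule X[of a]) (use a X'(2) in \<open>simp add: \<beta>q\<close>)
  qed
  have "si_error t A b V \<le> 2 * (B / (pi * (r / 2))) * vec_norm2 b"
  proof (rule field_le_epsilon)
    fix e :: real assume e: "e > 0"
    define \<delta> where "\<delta> = e / (2 * (vec_norm2 b + 1))"
    have n1: "vec_norm2 b + 1 > 0" using vec_norm2_nonneg[of b] by linarith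
    have \<delta>: "\<delta> > 0" unfolding \<delta>_def using e n1 by (intro divide_pos_pos mult_pos_pos) auto
    have "2 * \<delta> * vec_norm2 b \<le> 2 * \<delta> * (vec_norm2 b + 1)" using \<delta> by (intro mult_left_mono) auto
    also have "\<dots> = e" unfolding \<delta>_def using n1 by (simp add: divide_simps)
    finally show "si_error t A b V \<le> 2 * (B / (pi * (r / 2))) * vec_norm2 b + e"
      using approx[OF \<delta>] by (simp add: algebra_simps)
  qed
  also have "2 * (B / (pi * (r / 2))) = 8 / (r * sqrt (saddle_curvature r)) / sqrt (real m) * saddle_rate r ^ m"
    unfolding B_def real_sqrt_mult by simp
  finally show ?thesis .
qed

section \<open>The saddle rate and the root limit\<close>

text \<open>Since \<open>- r\<close> is a root of the cubic, the remaining factor is quadratic with root sum \<open>r\<close> and root product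
  \<open>r\<^sup>2 - 1\<close>.\<close>

lemma zeta_root_saddle:
  assumes r: "r > 2 / sqrt 3"
  shows "zeta_root (1 / (r * (r\<^sup>2 - 1))) = Complex (r / 2) (sqrt (3 * r\<^sup>2 / 4 - 1))"
proof -
  note range = saddle_range[OF r]
  define y where "y = sqrt (3 * r\<^sup>2 / 4 - 1)"
  have y: "y > 0" "y\<^sup>2 = 3 * r\<^sup>2 / 4 - 1" using range by (simp_all add: y_def)
  let ?\<zeta> = "Complex (r / 2) y"
  let ?k = "complex_of_real (r * (r\<^sup>2 - 1))"
  have k: "?k \<noteq> 0" using range(3) by (simp only: of_real_eq_0_iff)
  have factor: "z ^ 3 - z + ?k = (z + of_real r) * ((z - ?\<zeta>) * (z - cnj ?\<zeta>))" for z
  proof -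
    have "?\<zeta> + cnj ?\<zeta> = of_real r" by (simp add: complex_eq_iff)
    moreover have "?\<zeta> * cnj ?\<zeta> = of_real (r\<^sup>2 - 1)"
      using y(2) by (simp add: complex_eq_iff power2_eq_square)
    moreover have "(z - ?\<zeta>) * (z - cnj ?\<zeta>) = z\<^sup>2 - z * (?\<zeta> + cnj ?\<zeta>) + ?\<zeta> * cnj ?\<zeta>"
      by (simp only: power2_eq_square ring_distribs) (simp add: algebra_simps)
    ultimately have quad: "(z - ?\<zeta>) * (z - cnj ?\<zeta>) = z\<^sup>2 - z * of_real r + of_real (r\<^sup>2 - 1)"
      by (simp only:)
    show ?thesis
      unfolding quad by (simp add: power2_eq_square power3_eq_cube algebra_simps)
  qed
  have eqv: "complex_of_real (1 / (r * (r\<^sup>2 - 1))) * (z ^ 3 - z) + 1 = 0 \<longleftrightarrow> z ^ 3 - z + ?k = 0" for z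
  proof -
    have "complex_of_real (1 / (r * (r\<^sup>2 - 1))) * (z ^ 3 - z) + 1 = (z ^ 3 - z + ?k) / ?k"
      using k by (simp add: add_divide_distrib)
    thus ?thesis using k by simp
  qed
  show ?thesis
    unfolding zeta_root_def eqv factor y_def[symmetric]
  proof (rule the_equality)
    show "Re ?\<zeta> > 0 \<and> Im ?\<zeta> > 0 \<and> (?\<zeta> + of_real r) * ((?\<zeta> - ?\<zeta>) * (?\<zeta> - cnj ?\<zeta>)) = 0"
      using range y by simp
  next
    fix z assume z: "Re z > 0 \<and> Im z > 0 \<and> (z + of_real r) * ((z - ?\<zeta>) * (z - cnj ?\<zeta>)) = 0"
    have "z + of_real r \<noteq> 0" using z range by (auto simp: complex_eq_iff)
    moreover have "z - cnj ?\<zeta> \<noteq> 0" using z y by (auto simp: complex_eq_iff)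
    ultimately show "z = ?\<zeta>" using z by auto
  qed
qed

lemma H_e_saddle:
  assumes r: "r > 2 / sqrt 3"
  shows "H_e (1 / (r * (r\<^sup>2 - 1))) = saddle_rate r"
proof -
  note range = saddle_range[OF r]
  define y where "y = sqrt (3 * r\<^sup>2 / 4 - 1)"
  have y: "y\<^sup>2 = 3 * r\<^sup>2 / 4 - 1" using range by (simp add: y_def)
  let ?\<zeta> = "Complex (r / 2) y"
  have "(cmod (?\<zeta> - 1))\<^sup>2 = (r - 1) * r" "(cmod (?\<zeta> + 1))\<^sup>2 = (r + 1) * r"
    unfolding cmod_power2 by (simp_all add: y) (simp_all add: power2_eq_square field_simps)
  hence "(cmod ((?\<zeta> - 1) / (?\<zeta> + 1)))\<^sup>2 = (r - 1) / (r + 1)"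
    using range by (simp add: norm_divide power_divide)
  hence m: "cmod ((?\<zeta> - 1) / (?\<zeta> + 1)) = sqrt ((r - 1) / (r + 1))"
    by (metis norm_ge_zero real_sqrt_abs abs_of_nonneg)
  have "Re (?\<zeta>\<^sup>2) = (r / 2)\<^sup>2 - y\<^sup>2" by (simp add: power2_eq_square)
  also have "\<dots> = (2 - r\<^sup>2) / 2" unfolding y by (simp add: power_divide field_simps)
  finally have e: "Re (?\<zeta>\<^sup>2) = (2 - r\<^sup>2) / 2" .
  show ?thesis
    unfolding H_e_def zeta_root_saddle[OF r] y_def[symmetric] m e saddle_rate_def
    by (simp add: mult.assoc)
qed

text \<open>The function \<open>r (r\<^sup>2 - 1)\<close> takes the value \<open>1 / alpha_c\<close> at \<open>r = 2 / sqrt 3\<close>.\<close>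

lemma saddle_parameter_exists:
  assumes "0 < \<alpha>" "\<alpha> < alpha_c"
  obtains r where "r > 2 / sqrt 3" "r * (r\<^sup>2 - 1) = 1 / \<alpha>"
proof -
  define s where "s = 2 / sqrt 3"
  define M where "M = 2 + 1 / \<alpha>"
  let ?f = "\<lambda>r::real. r * (r\<^sup>2 - 1)"
  have s2: "s\<^sup>2 = 4 / 3" by (simp add: s_def power_divide)
  have "s < 2"
    by (rule power2_less_imp_less) (auto simp: s2)
  have fs: "?f s = 1 / alpha_c"
    unfolding s2 by (simp add: s_def alpha_c_def field_simps)
  have lt: "?f s < 1 / \<alpha>"
    unfolding fs using assms by (intro divide_strict_left_mono mult_pos_pos) auto
  have "M * 1 \<le> ?f M"
  proof (rule mult_left_mono)
    have "M \<ge> 2" using assms by (simp add: M_def)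
    hence "M * M \<ge> 2 * 2" by (intro mult_mono) auto
    thus "1 \<le> M\<^sup>2 - 1" by (simp add: power2_eq_square)
    show "0 \<le> M" using \<open>M \<ge> 2\<close> by simp
  qed
  moreover have "1 / \<alpha> \<le> M" by (simp add: M_def)
  ultimately have "1 / \<alpha> \<le> ?f M" by (metis mult_1_right order_trans)
  moreover have "s \<le> M" using \<open>s < 2\<close> assms by (simp add: M_def add_increasing2)
  moreover have cont: "continuous_on {s..M} ?f" by (intro continuous_intros)
  ultimately obtain r where "s \<le> r" "r \<le> M" "?f r = 1 / \<alpha>"
    using IVT'[of ?f s "1 / \<alpha>" M, OF less_imp_le[OF lt]] cont by auto
  moreover from this lt have "r \<noteq> s" by auto
  ultimately show ?thesis using that[of r] by (simp add: s_def)
qed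

text \<open>The inverse of \<open>r \<mapsto> r (r\<^sup>2 - 1)\<close> is non-expanding, since the difference quotient of this map exceeds 1
  on \<open>r > 1\<close>. Convergence of the parameters \<open>1 / \<alpha>\<close> therefore carries over to \<open>r\<close>.\<close>

lemma saddle_parameter_lipschitz:
  fixes r s :: real
  assumes "r > 1" "s > 1"
  shows "\<bar>r - s\<bar> \<le> \<bar>r * (r\<^sup>2 - 1) - s * (s\<^sup>2 - 1)\<bar>"
proof -
  have "r * (r\<^sup>2 - 1) - s * (s\<^sup>2 - 1) = (r - s) * (r * r + r * s + s * s - 1)"
    by (simp add: power2_eq_square algebra_simps)
  hence "\<bar>r * (r\<^sup>2 - 1) - s * (s\<^sup>2 - 1)\<bar> = \<bar>r - s\<bar> * \<bar>r * r + r * s + s * s - 1\<bar>"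
    by (simp only: abs_mult)
  moreover have "1 \<le> \<bar>r * r + r * s + s * s - 1\<bar>"
  proof -
    have "1 * 1 \<le> r * r" "1 * 1 \<le> r * s" "1 * 1 \<le> s * s" using assms by (intro mult_mono; simp)+
    thus ?thesis by linarith
  qed
  ultimately show ?thesis
    using mult_left_mono[of 1 "\<bar>r * r + r * s + s * s - 1\<bar>" "\<bar>r - s\<bar>"] by simp
qed

lemma sqrt2_in_saddle_range: "sqrt 2 > 2 / sqrt 3"
  by (rule power2_less_imp_less) (simp_all add: power_divide)

lemma saddle_rate_sqrt2: "saddle_rate (sqrt 2) = sqrt 2 - 1"
proof -
  have nz: "sqrt 2 + 1 \<noteq> (0 :: real)" using real_sqrt_ge_zero[of 2] by linarith
  have "(sqrt 2 - 1) / (sqrt 2 + 1) = (sqrt 2 - 1)\<^sup>2"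
    by (subst nonzero_divide_eq_eq[OF nz]) (simp add: power2_eq_square algebra_simps)
  thus ?thesis by (simp add: saddle_rate_def)
qed

lemma H_e_alpha_star: "H_e alpha_star = sqrt 2 - 1"
  using H_e_saddle[OF sqrt2_in_saddle_range] by (simp add: alpha_star_def saddle_rate_sqrt2)

text \<open>Each index \<open>N\<close> has its own parameter \<open>\<alpha> N / m N\<close>, and hence its own \<open>\<rho> N\<close> and its own contour. As
  \<open>\<rho> N\<close> tends to \<open>r\<close>, the constants of the error bound stay bounded, and their \<open>m N\<close>-th roots tend to 1.\<close>

lemma si_root_limsup_le:
  assumes t: "t > 0" and \<alpha>: "\<alpha> > 0" and \<theta>: "\<theta> > 0"
    and m: "(\<lambda>N. real (m N) / real N) \<longlonglongrightarrow> \<theta>"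
    and sub: "\<alpha> / \<theta> < alpha_c" and seq: "si_sequence t \<alpha> m n A b V"
  shows "si_root_limsup t m A b V \<le> ereal (H_e (\<alpha> / \<theta>))"
proof -
  obtain r where r: "r > 2 / sqrt 3" "r * (r\<^sup>2 - 1) = \<theta> / \<alpha>"
    using saddle_parameter_exists[of "\<alpha> / \<theta>"] \<alpha> \<theta> sub by auto
  note range = saddle_range[OF r(1)]
  define K where "K r = 8 / (r * sqrt (saddle_curvature r))" for r
  have H: "H_e (\<alpha> / \<theta>) = saddle_rate r"
    using H_e_saddle[OF r(1)] unfolding r(2) by simp
  have ratio: "(\<lambda>N. real (m N) / (\<alpha> * real N)) \<longlonglongrightarrow> \<theta> / \<alpha>"
    using tendsto_divide[OF m tendsto_const[of \<alpha>]] \<alpha> by (simp add: mult.commute)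
  have "\<forall>\<^sub>F N in sequentially. real (m N) / (\<alpha> * real N) > 1 / alpha_c"
    using sub \<alpha> \<theta> by (intro order_tendstoD(1)[OF ratio]) (simp add: field_simps alpha_c_def)
  hence ev: "\<forall>\<^sub>F N in sequentially. N \<ge> 1 \<and> real (m N) / (\<alpha> * real N) > 1 / alpha_c"
    using eventually_ge_at_top[of 1] by eventually_elim auto
  define \<rho> where "\<rho> N = (SOME s. s > 2 / sqrt 3 \<and> s * (s\<^sup>2 - 1) = real (m N) / (\<alpha> * real N))" for N
  have \<rho>: "\<forall>\<^sub>F N in sequentially. N \<ge> 1 \<and> m N \<ge> 1 \<and> \<rho> N > 2 / sqrt 3 \<and>
      \<rho> N * ((\<rho> N)\<^sup>2 - 1) = real (m N) / (\<alpha> * real N)"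
    using ev
  proof eventually_elim
    case (elim N)
    have ac: "alpha_c > 0" by (simp add: alpha_c_def)
    have "1 / alpha_c > 0" using ac by simp
    hence mpos: "real (m N) / (\<alpha> * real N) > 0" using elim by linarith
    hence m1: "m N \<ge> 1" by (cases "m N") auto
    have "1 / (real (m N) / (\<alpha> * real N)) < 1 / (1 / alpha_c)"
      using elim mpos ac by (intro divide_strict_left_mono mult_pos_pos) auto
    hence "1 / (real (m N) / (\<alpha> * real N)) < alpha_c" by simp
    moreover have "0 < 1 / (real (m N) / (\<alpha> * real N))" by (rule divide_pos_pos, simp, rule mpos)
    ultimately obtain s where s: "s > 2 / sqrt 3" "s * (s\<^sup>2 - 1) = 1 / (1 / (real (m N) / (\<alpha> * real N)))"
      using saddle_parameter_exists by metis
    hence "s > 2 / sqrt 3 \<and> s * (s\<^sup>2 - 1) = real (m N) / (\<alpha> * real N)" by simp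
    hence "\<rho> N > 2 / sqrt 3 \<and> \<rho> N * ((\<rho> N)\<^sup>2 - 1) = real (m N) / (\<alpha> * real N)"
      unfolding \<rho>_def by (rule someI)
    thus ?case using elim m1 by simp
  qed
  have lim_\<rho>: "\<rho> \<longlonglongrightarrow> r"
  proof (rule LIM_zero_cancel, rule Lim_null_comparison)
    show "\<forall>\<^sub>F N in sequentially. norm (\<rho> N - r) \<le> \<bar>real (m N) / (\<alpha> * real N) - \<theta> / \<alpha>\<bar>"
      using \<rho>
    proof eventually_elim
      case (elim N)
      thus ?case using saddle_parameter_lipschitz[of "\<rho> N" r] saddle_range(1)[of "\<rho> N"] range(1) r(2) by simp
    qed
    show "(\<lambda>N. \<bar>real (m N) / (\<alpha> * real N) - \<theta> / \<alpha>\<bar>) \<longlonglongrightarrow> 0"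
      using tendsto_rabs_zero[OF LIM_zero[OF ratio]] .
  qed
  have nz: "r \<noteq> 0" "r + 1 \<noteq> 0" "r\<^sup>2 - 1 \<noteq> 0" "1 + r / 2 \<noteq> 0" "2 * r * (r\<^sup>2 - 1) \<noteq> 0"
    "r * (r\<^sup>2 - 1) \<noteq> 0" "(1 + r / 2)\<^sup>2 \<noteq> 0"
    using range by auto
  have lim_rate: "(\<lambda>N. saddle_rate (\<rho> N)) \<longlonglongrightarrow> saddle_rate r"
    unfolding saddle_rate_def by (intro tendsto_intros lim_\<rho> nz)
  have lim_K: "(\<lambda>N. K (\<rho> N)) \<longlonglongrightarrow> K r"
    unfolding K_def
  proof (intro tendsto_intros lim_\<rho>)
    show "(\<lambda>N. saddle_curvature (\<rho> N)) \<longlonglongrightarrow> saddle_curvature r"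
      unfolding saddle_curvature_def by (intro tendsto_intros lim_\<rho> nz) simp_all
    show "r * sqrt (saddle_curvature r) \<noteq> 0"
      using saddle_curvature_pos[OF r(1)] nz by simp
  qed
  have Kr: "K r > 0" using saddle_curvature_pos[OF r(1)] range by (simp add: K_def)
  have evK: "\<forall>\<^sub>F N in sequentially. K (\<rho> N) < K r + 1"
    by (rule order_tendstoD(2)[OF lim_K]) simp
  have m_top: "filterlim (\<lambda>N. real (m N)) at_top sequentially"
  proof -
    have "filterlim (\<lambda>N. real (m N) / real N * real N) at_top sequentially"
      by (rule filterlim_tendsto_pos_mult_at_top[OF m \<theta> filterlim_real_sequentially])
    moreover have "\<forall>\<^sub>F N in sequentially. real (m N) / real N * real N = real (m N)"
      using eventually_ge_at_top[of 1] by eventually_elim simp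
    ultimately show ?thesis by (simp cong: filterlim_cong)
  qed
  have "\<forall>\<^sub>F N in sequentially.
      ereal ((si_error t (A N) (b N) (V N) / vec_norm2 (b N)) powr (1 / real (m N)))
      \<le> ereal ((K r + 1) powr (1 / real (m N)) * saddle_rate (\<rho> N))"
    using \<rho> evK
  proof eventually_elim
    case (elim N)
    hence N: "N \<ge> 1" "m N \<ge> 1" "\<rho> N > 2 / sqrt 3"
      "\<rho> N * ((\<rho> N)\<^sup>2 - 1) = real (m N) / (\<alpha> * real N)" by auto
    have data: "hermitian_nsd (n N) (A N)" "b N \<in> carrier_vec (n N)" "b N \<noteq> 0\<^sub>v (n N)"
      "si_basis (A N) (b N) (\<alpha> * real N / t) (m N) (V N)"
      using seq N unfolding si_sequence_def by auto
    have bpos: "vec_norm2 (b N) > 0" by (rule vec_norm2_pos[OF data(2,3)])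
    have q: "\<alpha> * real N / t = real (m N) / (t * (\<rho> N * ((\<rho> N)\<^sup>2 - 1)))"
      unfolding N(4) using N \<alpha> by (simp add: field_simps)
    have rate: "saddle_rate (\<rho> N) > 0" using saddle_rate_pos saddle_range(1)[OF N(3)] by blast
    have "si_error t (A N) (b N) (V N)
        \<le> K (\<rho> N) / sqrt (real (m N)) * saddle_rate (\<rho> N) ^ m N * vec_norm2 (b N)"
      unfolding K_def by (rule si_error_bound[OF t N(3,2) q data(1,2,4)])
    also have "K (\<rho> N) / sqrt (real (m N)) \<le> K r + 1"
    proof -
      have "1 / sqrt (real (m N)) \<le> 1" using N by simp
      moreover have "K (\<rho> N) \<ge> 0"
        using saddle_curvature_pos[OF N(3)] saddle_range(1)[OF N(3)] by (simp add: K_def)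
      ultimately have "K (\<rho> N) * (1 / sqrt (real (m N))) \<le> K (\<rho> N) * 1" by (rule mult_left_mono)
      thus ?thesis using elim by simp
    qed
    finally have "si_error t (A N) (b N) (V N) / vec_norm2 (b N) \<le> (K r + 1) * saddle_rate (\<rho> N) ^ m N"
      using bpos rate by (simp add: divide_le_eq mult_right_mono)
    hence "(si_error t (A N) (b N) (V N) / vec_norm2 (b N)) powr (1 / real (m N))
        \<le> ((K r + 1) * saddle_rate (\<rho> N) ^ m N) powr (1 / real (m N))"
      using bpos by (intro powr_mono2) (auto simp: si_error_def)
    also have "\<dots> = (K r + 1) powr (1 / real (m N)) * saddle_rate (\<rho> N)"
      using Kr rate N by (simp add: powr_mult powr_realpow[symmetric] powr_powr)
    finally show ?case by simp
  qed
  hence "si_root_limsup t m A b V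
      \<le> limsup (\<lambda>N. ereal ((K r + 1) powr (1 / real (m N)) * saddle_rate (\<rho> N)))"
    unfolding si_root_limsup_def by (rule Limsup_mono)
  also have "\<dots> = ereal (saddle_rate r)"
  proof (rule lim_imp_Limsup)
    have "(\<lambda>N. 1 / real (m N)) \<longlonglongrightarrow> 0"
      using tendsto_inverse_0_at_top[OF m_top] by (simp add: inverse_eq_divide)
    hence "(\<lambda>N. (K r + 1) powr (1 / real (m N))) \<longlonglongrightarrow> (K r + 1) powr 0"
      using Kr by (intro tendsto_intros) auto
    hence "(\<lambda>N. (K r + 1) powr (1 / real (m N)) * saddle_rate (\<rho> N)) \<longlonglongrightarrow> 1 * saddle_rate r"
      using Kr by (intro tendsto_mult lim_rate) auto
    thus "(\<lambda>N. ereal ((K r + 1) powr (1 / real (m N)) * saddle_rate (\<rho> N))) \<longlonglongrightarrow> ereal (saddle_rate r)"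
      by simp
  qed simp
  finally show ?thesis unfolding H .
qed

section \<open>The degree rule\<close>

text \<open>With \<open>L = log (1 / \<epsilon>)\<close> the hypothesis gives \<open>(sqrt 2 - 1)\<^sup>m \<le> \<epsilon> sqrt L exp (- a C0)\<close>. As \<open>log L \<le> L\<close>, it also
  gives \<open>m \<ge> L / (2 a)\<close>, so that \<open>1 / sqrt m\<close> cancels \<open>sqrt L\<close> up to a constant, which \<open>C0\<close> absorbs.\<close>

lemma degree_rule_sufficient:
  fixes C :: real
  assumes C: "C > 0"
  defines "a \<equiv> arsinh (1 :: real)"
  obtains C0 where "\<And>\<epsilon> m. 0 < \<epsilon> \<Longrightarrow> \<epsilon> < exp (-1) \<Longrightarrow>
      (ln (1 / \<epsilon>) - 1 / 2 * ln (ln (1 / \<epsilon>))) / a + C0 \<le> real m \<Longrightarrow>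
      m \<ge> 1 \<and> C / sqrt (real m) * (sqrt 2 - 1) ^ m \<le> \<epsilon>"
proof -
  have a_eq: "a = ln (1 + sqrt 2)" by (simp add: a_def arsinh_real_def)
  have a: "a > 0" unfolding a_eq by (rule ln_gt_zero) simp
  have "(sqrt 2 - 1) * (1 + sqrt 2) = 1" by (simp add: algebra_simps)
  hence rate: "sqrt 2 - 1 = exp (- a)"
    unfolding a_eq exp_minus using real_sqrt_ge_zero[of 2]
    by (simp add: add_pos_nonneg inverse_eq_divide eq_divide_eq add_nonneg_eq_0_iff)
  \<comment> \<open>The maximum with 0 is what makes \<open>m \<ge> L / (2 a)\<close> available.\<close>
  define C0 where "C0 = max 0 (ln (C * sqrt (2 * a)) / a)"
  have "ln (C * sqrt (2 * a)) \<le> a * C0"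
    using mult_left_mono[OF max.cobounded2[of "ln (C * sqrt (2 * a)) / a" 0], of a] a by (simp add: C0_def)
  hence C0: "C * sqrt (2 * a) * exp (- (a * C0)) \<le> 1"
  proof -
    have "C * sqrt (2 * a) = exp (ln (C * sqrt (2 * a)))" using C a by simp
    also have "\<dots> \<le> exp (a * C0)" using \<open>ln (C * sqrt (2 * a)) \<le> a * C0\<close> by (subst exp_le_cancel_iff)
    finally show ?thesis by (simp add: exp_minus inverse_eq_divide)
  qed
  show ?thesis
  proof (rule that[of C0])
    fix \<epsilon> and m :: nat
    assume \<epsilon>: "0 < \<epsilon>" "\<epsilon> < exp (-1)"
      and m: "(ln (1 / \<epsilon>) - 1 / 2 * ln (ln (1 / \<epsilon>))) / a + C0 \<le> real m"
    define L where "L = ln (1 / \<epsilon>)"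
    have "ln \<epsilon> < ln (exp (-1))" using \<epsilon> by (subst ln_less_cancel_iff) auto
    hence L: "L > 1" using \<epsilon> by (simp add: L_def ln_div)
    have expL: "exp (- L) = \<epsilon>" using \<epsilon> by (simp add: L_def ln_div)
    have "ln L \<le> L - 1" using L by (intro ln_le_minus_one) auto
    hence "L / 2 \<le> L - 1 / 2 * ln L" using L by simp
    hence "L / 2 / a \<le> (L - 1 / 2 * ln L) / a" using a by (intro divide_right_mono) auto
    also have "\<dots> \<le> real m" using m by (simp add: L_def[symmetric] C0_def)
    finally have mL: "L / (2 * a) \<le> real m" by simp
    have Lp: "L / (2 * a) > 0" using L a by simp
    hence m0: "real m > 0" using mL by linarith
    have rt: "1 / sqrt (real m) \<le> sqrt (2 * a) / sqrt L"
    proof -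
      have "1 / sqrt (real m) \<le> 1 / sqrt (L / (2 * a))"
        using mL Lp by (intro divide_left_mono) auto
      thus ?thesis by (simp add: real_sqrt_divide)
    qed
    have "a * ((L - 1 / 2 * ln L) / a + C0) \<le> a * real m"
      using m a by (intro mult_left_mono) (auto simp: L_def)
    hence "- (a * real m) \<le> - L + 1 / 2 * ln L - a * C0"
      using a by (simp add: distrib_left)
    moreover have "(sqrt 2 - 1) ^ m = exp (- (a * real m))"
      unfolding rate by (simp add: exp_of_nat_mult[symmetric] mult.commute)
    ultimately have "(sqrt 2 - 1) ^ m \<le> exp (- L + 1 / 2 * ln L - a * C0)" by simp
    also have "\<dots> = \<epsilon> * sqrt L * exp (- (a * C0))"
    proof -
      have half: "exp (1 / 2 * ln L) = sqrt L"
      proof -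
        have "sqrt L = L powr (1 / 2)" by (rule powr_half_sqrt[symmetric]) (use L in simp)
        also have "\<dots> = exp (1 / 2 * ln L)" using L by (subst powr_def) auto
        finally show ?thesis ..
      qed
      have "exp (- L + h - k) = exp (- L) * exp h * exp (- k)" for h k
        unfolding exp_add[symmetric] by simp
      thus ?thesis unfolding expL[symmetric] half[symmetric] .
    qed
    finally have pow: "(sqrt 2 - 1) ^ m \<le> \<epsilon> * sqrt L * exp (- (a * C0))" .
    have "C / sqrt (real m) * (sqrt 2 - 1) ^ m = C * (1 / sqrt (real m) * (sqrt 2 - 1) ^ m)" by simp
    also have "\<dots> \<le> C * (sqrt (2 * a) / sqrt L * (\<epsilon> * sqrt L * exp (- (a * C0))))"
      using C \<epsilon> L a by (intro mult_left_mono mult_mono rt pow) auto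
    also have "\<dots> = \<epsilon> * (C * sqrt (2 * a) * exp (- (a * C0)))"
      using L by simp
    also have "\<dots> \<le> \<epsilon> * 1" using \<epsilon> C0 by (intro mult_left_mono) auto
    finally show "m \<ge> 1 \<and> C / sqrt (real m) * (sqrt 2 - 1) ^ m \<le> \<epsilon>" using m0 by simp
  qed
qed

section \<open>The rate near its optimal parameter\<close>

lemma alpha_star_less_alpha_c:
  assumes "s > 1 / 2"
  shows "alpha_star / s < alpha_c"
proof -
  have "alpha_star / s < alpha_star / (1 / 2)"
    using assms by (intro divide_strict_left_mono) (auto simp: alpha_star_def)
  also have "\<dots> = sqrt 2" by (simp add: alpha_star_def field_simps)
  also have "\<dots> < alpha_c"
    by (rule power2_less_imp_less) (simp_all add: alpha_c_def power_divide power_mult_distrib)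
  finally show ?thesis .
qed

lemma ln_saddle_rate:
  assumes "r > 1"
  shows "ln (saddle_rate r) = (ln (r - 1) - ln (r + 1)) / 2 + (2 - r\<^sup>2) / (2 * r * (r\<^sup>2 - 1))"
  using assms by (simp add: saddle_rate_def ln_mult ln_sqrt ln_div)

text \<open>Here \<open>(r (r\<^sup>2 - 1) - sqrt 2) / sqrt 2\<close> is the perturbation \<open>\<epsilon>\<close> as a function of \<open>r\<close>. The derivative of the
  difference \<open>D\<close> inside the absolute value factors as \<open>(3 r\<^sup>2 - 1) (r - sqrt 2) G(r)\<close> where \<open>G\<close> vanishes at \<open>sqrt 2\<close> too:
  this second zero is what fixes the coefficient \<open>1 / (5 sqrt 2)\<close>. So the derivative is
  \<open>O((r - sqrt 2)\<^sup>2)\<close>, and the mean value theorem gives the cubic bound.\<close>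

lemma ln_saddle_rate_expansion:
  obtains K where "K > 0" "\<forall>\<^sub>F r in nhds (sqrt 2).
    \<bar>ln (saddle_rate r) - (ln (sqrt 2 - 1) + ((r * (r\<^sup>2 - 1) - sqrt 2) / sqrt 2)\<^sup>2 / (5 * sqrt 2))\<bar>
      \<le> K * \<bar>r - sqrt 2\<bar> ^ 3"
proof -
  define w where "w = sqrt 2"
  have w2: "w * w = 2" by (simp add: w_def)
  have w: "1 < w" "w < 2" by (simp_all add: w_def real_less_lsqrt)
  define G where "G s = (s + w) / (2 * s\<^sup>2 * (s\<^sup>2 - 1)\<^sup>2) - (s\<^sup>2 + w * s + 1) / (5 * w)" for s
  have Gw: "G w = 0"
    unfolding G_def power2_eq_square w2 using w w2 by (simp add: field_simps)
  define D where "D r = (ln (r - 1) - ln (r + 1)) / 2 + (2 - r\<^sup>2) / (2 * r * (r\<^sup>2 - 1))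
     - ln (w - 1) - (r * (r\<^sup>2 - 1) - w)\<^sup>2 / (10 * w)" for r
  have Dw: "D w = 0"
  proof -
    have "ln (w - 1) = (ln (w - 1) - ln (w + 1)) / 2"
    proof -
      have "(w - 1) * (w + 1) = 1" using w2 by (simp add: algebra_simps)
      hence "ln (w - 1) + ln (w + 1) = 0" using w ln_mult[of "w - 1" "w + 1"] by simp
      thus ?thesis by simp
    qed
    thus ?thesis using w2 by (simp add: D_def power2_eq_square)
  qed
  have derD: "(D has_real_derivative (3 * s\<^sup>2 - 1) * (s - w) * G s) (at s)" if s: "s > 1" for s
  proof -
    have s0: "s\<^sup>2 - 1 > 0" using s power_strict_mono[of 1 s 2] by simp
    have e1: "(1 / (s - 1) - 1 / (s + 1)) / 2 = 1 / (s\<^sup>2 - 1)"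
      using s s0 by (simp add: divide_simps power2_eq_square) (simp add: algebra_simps)
    have "(D has_real_derivative (1 / (s - 1) - 1 / (s + 1)) / 2
       + (- (2 * s) * (2 * s * (s\<^sup>2 - 1)) - (2 - s\<^sup>2) * (2 * (s\<^sup>2 - 1) + 2 * s * (2 * s))) / (2 * s * (s\<^sup>2 - 1))\<^sup>2
       - 0 - 2 * (s * (s\<^sup>2 - 1) - w) * (s\<^sup>2 - 1 + s * (2 * s)) / (10 * w)) (at s)"
      unfolding D_def
    proof (intro DERIV_diff DERIV_add)
      show "((\<lambda>r. (ln (r - 1) - ln (r + 1)) / 2) has_real_derivative (1 / (s - 1) - 1 / (s + 1)) / 2) (at s)"
        using s by (intro DERIV_cdivide) (auto intro!: derivative_eq_intros)
      show "((\<lambda>r. (2 - r\<^sup>2) / (2 * r * (r\<^sup>2 - 1))) has_real_derivative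
         (- (2 * s) * (2 * s * (s\<^sup>2 - 1)) - (2 - s\<^sup>2) * (2 * (s\<^sup>2 - 1) + 2 * s * (2 * s))) / (2 * s * (s\<^sup>2 - 1))\<^sup>2) (at s)"
        using s s0 by (auto intro!: derivative_eq_intros simp: power2_eq_square)
      show "((\<lambda>r. (r * (r\<^sup>2 - 1) - w)\<^sup>2 / (10 * w)) has_real_derivative
         2 * (s * (s\<^sup>2 - 1) - w) * (s\<^sup>2 - 1 + s * (2 * s)) / (10 * w)) (at s)"
        by (intro DERIV_cdivide) (auto intro!: derivative_eq_intros simp: power2_eq_square)
    qed (rule DERIV_const)
    also have "(1 / (s - 1) - 1 / (s + 1)) / 2
       + (- (2 * s) * (2 * s * (s\<^sup>2 - 1)) - (2 - s\<^sup>2) * (2 * (s\<^sup>2 - 1) + 2 * s * (2 * s))) / (2 * s * (s\<^sup>2 - 1))\<^sup>2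
       = (3 * s\<^sup>2 - 1) * ((s - w) * (s + w)) / (2 * s\<^sup>2 * (s\<^sup>2 - 1)\<^sup>2)"
    proof -
      \<comment> \<open>In the variable \<open>z\<close> both sides have the denominator \<open>2 (z + 1) z\<^sup>2\<close>.\<close>
      define z where "z = s\<^sup>2 - 1"
      have z: "z > 0" "s\<^sup>2 = z + 1" using s0 by (simp_all add: z_def)
      have sw: "(s - w) * (s + w) = z - 1" using w2 z by (simp add: algebra_simps power2_eq_square)
      have n: "- (2 * s) * (2 * s * z) - (2 - s\<^sup>2) * (2 * z + 2 * s * (2 * s))
          = - 4 * (z + 1) * z - (1 - z) * (2 * z + 4 * (z + 1))"
        using z(2) by (simp add: power2_eq_square algebra_simps)
      have d: "(2 * s * z)\<^sup>2 = 4 * (z + 1) * z\<^sup>2" using z(2) by (simp add: power_mult_distrib)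
      show ?thesis
        unfolding e1 z_def[symmetric] n d sw unfolding z(2) using z(1)
        by (simp add: divide_simps power2_eq_square add_pos_pos) (simp add: algebra_simps)
    qed
    also have "2 * (s * (s\<^sup>2 - 1) - w) * (s\<^sup>2 - 1 + s * (2 * s)) / (10 * w)
       = (3 * s\<^sup>2 - 1) * ((s - w) * (s\<^sup>2 + w * s + 1)) / (5 * w)"
    proof -
      have "(s - w) * (s\<^sup>2 + w * s + 1) = s * s\<^sup>2 + s - w - (w * w) * s"
        by (simp add: algebra_simps power2_eq_square)
      also have "\<dots> = s * (s\<^sup>2 - 1) - w" unfolding w2 by (simp add: algebra_simps)
      finally have p1: "(s - w) * (s\<^sup>2 + w * s + 1) = s * (s\<^sup>2 - 1) - w" .
      have p2: "s\<^sup>2 - 1 + s * (2 * s) = 3 * s\<^sup>2 - 1" by (simp add: power2_eq_square)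
      have "2 * x * y / (10 * w) = y * x / (5 * w)" for x y :: real by simp
      thus ?thesis unfolding p1 p2 .
    qed
    also have "(3 * s\<^sup>2 - 1) * ((s - w) * (s + w)) / (2 * s\<^sup>2 * (s\<^sup>2 - 1)\<^sup>2) - 0
       - (3 * s\<^sup>2 - 1) * ((s - w) * (s\<^sup>2 + w * s + 1)) / (5 * w) = (3 * s\<^sup>2 - 1) * (s - w) * G s"
    proof -
      have "x * (y * p) / m - 0 - x * (y * k) / n = x * y * (p / m - k / n)" for x y p m k n :: real
        by (simp add: right_diff_distrib mult.assoc)
      thus ?thesis unfolding G_def .
    qed
    finally show ?thesis .
  qed
  have "\<exists>G'. (G has_real_derivative G') (at w)"
    unfolding G_def using w w2 by (auto intro!: exI derivative_eq_intros simp: power2_eq_square)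
  then obtain G' where G': "(G has_real_derivative G') (at w)" by blast
  define M where "M = \<bar>G'\<bar> + 1"
  have "((\<lambda>s. \<bar>G s / (s - w)\<bar>) \<longlongrightarrow> \<bar>G'\<bar>) (at w)"
    using G' unfolding has_field_derivative_iff Gw by (intro tendsto_rabs) simp
  hence "\<forall>\<^sub>F s in at w. \<bar>G s / (s - w)\<bar> < M"
    by (rule order_tendstoD(2)) (simp add: M_def)
  then obtain d where d: "d > 0" "\<And>s. s \<noteq> w \<Longrightarrow> dist s w < d \<Longrightarrow> \<bar>G s / (s - w)\<bar> < M"
    unfolding eventually_at by auto
  have Gle: "\<bar>G s\<bar> \<le> M * \<bar>s - w\<bar>" if "\<bar>s - w\<bar> < d" for s
  proof (cases "s = w")
    case False
    hence "\<bar>G s\<bar> / \<bar>s - w\<bar> < M" using d(2)[of s] that by (simp add: dist_real_def)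
    thus ?thesis using False by (simp add: divide_less_eq)
  qed (simp add: Gw)
  \<comment> \<open>This radius keeps the interval inside \<open>(1, 2)\<close>, where \<open>3 r\<^sup>2 - 1 \<le> 11\<close>.\<close>
  define e where "e = min d (min (w - 1) (2 - w))"
  have e: "e > 0" using d w by (simp add: e_def)
  have main: "\<bar>D r\<bar> \<le> 11 * M * \<bar>r - w\<bar> ^ 3" if r: "\<bar>r - w\<bar> < e" for r
  proof -
    have bound: "\<bar>(3 * s\<^sup>2 - 1) * (s - w) * G s\<bar> \<le> 11 * M * \<bar>r - w\<bar>\<^sup>2"
      if "\<bar>s - w\<bar> \<le> \<bar>r - w\<bar>" for s
    proof -
      have s: "1 < s" "s < 2" "\<bar>s - w\<bar> < d" using that r by (auto simp: e_def)
      have "s\<^sup>2 \<le> 2\<^sup>2" "1 \<le> s\<^sup>2" using s power_mono[of s 2 2] power_mono[of 1 s 2] by auto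
      hence "\<bar>3 * s\<^sup>2 - 1\<bar> \<le> 11" by simp
      moreover have "\<bar>G s\<bar> \<le> M * \<bar>r - w\<bar>"
        using Gle[OF s(3)] mult_left_mono[OF that, of M] by (simp add: M_def)
      ultimately have "\<bar>3 * s\<^sup>2 - 1\<bar> * \<bar>s - w\<bar> * \<bar>G s\<bar> \<le> 11 * \<bar>r - w\<bar> * (M * \<bar>r - w\<bar>)"
        using that by (intro mult_mono) auto
      moreover have "11 * z * (M * z) = 11 * M * z\<^sup>2" for z :: real by (simp add: power2_eq_square)
      ultimately show ?thesis by (simp only: abs_mult)
    qed
    have "norm (D r - D w) \<le> 11 * M * \<bar>r - w\<bar>\<^sup>2 * norm (r - w)"
    proof (rule field_differentiable_bound[of "cball w \<bar>r - w\<bar>" D])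
      fix s assume "s \<in> cball w \<bar>r - w\<bar>"
      hence sr: "\<bar>s - w\<bar> \<le> \<bar>r - w\<bar>" by (simp add: dist_real_def abs_minus_commute)
      hence "s > 1" using r by (auto simp: e_def)
      thus "(D has_real_derivative (3 * s\<^sup>2 - 1) * (s - w) * G s) (at s within cball w \<bar>r - w\<bar>)"
        using derD has_field_derivative_at_within by blast
      show "norm ((3 * s\<^sup>2 - 1) * (s - w) * G s) \<le> 11 * M * \<bar>r - w\<bar>\<^sup>2"
        using bound[OF sr] by simp
    qed (auto simp: dist_real_def)
    moreover have "11 * M * z\<^sup>2 * z = 11 * M * z ^ 3" for z :: real
      by (simp add: power3_eq_cube power2_eq_square)
    ultimately show ?thesis by (simp only: Dw diff_zero real_norm_def)
  qed
  show ?thesis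
  proof (rule that[of "11 * M"])
    show "11 * M > 0" by (simp add: M_def add_nonneg_pos)
    have "\<forall>\<^sub>F r in nhds w. \<bar>r - w\<bar> < e"
      unfolding eventually_nhds_metric using e by (auto simp: dist_real_def)
    thus "\<forall>\<^sub>F r in nhds (sqrt 2).
      \<bar>ln (saddle_rate r) - (ln (sqrt 2 - 1) + ((r * (r\<^sup>2 - 1) - sqrt 2) / sqrt 2)\<^sup>2 / (5 * sqrt 2))\<bar>
        \<le> 11 * M * \<bar>r - sqrt 2\<bar> ^ 3"
      unfolding w_def[symmetric]
    proof eventually_elim
      case (elim r)
      have "r > 1" using elim by (auto simp: e_def)
      have "((r * (r\<^sup>2 - 1) - w) / w)\<^sup>2 / (5 * w) = (r * (r\<^sup>2 - 1) - w)\<^sup>2 / (10 * w)"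
        by (simp add: power_divide power2_eq_square[of w] w2)
      hence "ln (saddle_rate r) - (ln (w - 1) + ((r * (r\<^sup>2 - 1) - w) / w)\<^sup>2 / (5 * w)) = D r"
        by (simp add: ln_saddle_rate[OF \<open>r > 1\<close>] D_def)
      thus ?case using main[OF elim] by simp
    qed
  qed
qed

lemma ln_H_e_expansion:
  "(\<lambda>\<epsilon>. ln (H_e (alpha_star / (1 + \<epsilon>))) - (ln (sqrt 2 - 1) + \<epsilon>\<^sup>2 / (5 * sqrt 2))) \<in> O[at 0](\<lambda>\<epsilon>. \<epsilon> ^ 3)"
proof -
  define F where "F r = ln (saddle_rate r)
    - (ln (sqrt 2 - 1) + ((r * (r\<^sup>2 - 1) - sqrt 2) / sqrt 2)\<^sup>2 / (5 * sqrt 2))" for r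
  obtain K where K: "K > 0" and "\<forall>\<^sub>F r in nhds (sqrt 2). \<bar>F r\<bar> \<le> K * \<bar>r - sqrt 2\<bar> ^ 3"
    unfolding F_def by (rule ln_saddle_rate_expansion)
  then obtain d where d: "d > 0" "\<And>r. \<bar>r - sqrt 2\<bar> < d \<Longrightarrow> \<bar>F r\<bar> \<le> K * \<bar>r - sqrt 2\<bar> ^ 3"
    unfolding eventually_nhds_metric by (auto simp: dist_real_def)
  define e where "e = min (1 / 4) (d / sqrt 2)"
  have e: "e > 0" using d by (simp add: e_def)
  have main: "\<bar>ln (H_e (alpha_star / (1 + \<epsilon>))) - (ln (sqrt 2 - 1) + \<epsilon>\<^sup>2 / (5 * sqrt 2))\<bar>
      \<le> K * sqrt 2 ^ 3 * \<bar>\<epsilon>\<bar> ^ 3" if \<epsilon>: "\<bar>\<epsilon>\<bar> < e" for \<epsilon>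
  proof -
    have "\<bar>\<epsilon>\<bar> < 1 / 4" using \<epsilon> by (simp add: e_def)
    hence e1: "1 + \<epsilon> > 3 / 4" by linarith
    have "alpha_star / (1 + \<epsilon>) < alpha_c"
      using e1 by (intro alpha_star_less_alpha_c) simp
    moreover have "alpha_star / (1 + \<epsilon>) > 0" using e1 by (simp add: alpha_star_def)
    ultimately obtain r where r: "r > 2 / sqrt 3" "r * (r\<^sup>2 - 1) = 1 / (alpha_star / (1 + \<epsilon>))"
      using saddle_parameter_exists by metis
    have re: "r * (r\<^sup>2 - 1) = sqrt 2 * (1 + \<epsilon>)" unfolding r(2) by (simp add: alpha_star_def)
    have "H_e (1 / (r * (r\<^sup>2 - 1))) = saddle_rate r" by (rule H_e_saddle[OF r(1)])
    hence H: "H_e (alpha_star / (1 + \<epsilon>)) = saddle_rate r" unfolding r(2) by simp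
    have "\<bar>r - sqrt 2\<bar> \<le> \<bar>r * (r\<^sup>2 - 1) - sqrt 2 * ((sqrt 2)\<^sup>2 - 1)\<bar>"
      by (rule saddle_parameter_lipschitz) (use saddle_range(1)[OF r(1)] in auto)
    also have "\<dots> = sqrt 2 * \<bar>\<epsilon>\<bar>" unfolding re by (simp add: algebra_simps abs_mult)
    finally have close: "\<bar>r - sqrt 2\<bar> \<le> sqrt 2 * \<bar>\<epsilon>\<bar>" .
    also have "\<dots> < d" using \<epsilon> by (simp add: e_def field_simps)
    finally have "\<bar>F r\<bar> \<le> K * \<bar>r - sqrt 2\<bar> ^ 3" by (rule d(2))
    also have "\<dots> \<le> K * (sqrt 2 * \<bar>\<epsilon>\<bar>) ^ 3"
      using K close by (intro mult_left_mono power_mono) auto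
    finally have "\<bar>F r\<bar> \<le> K * sqrt 2 ^ 3 * \<bar>\<epsilon>\<bar> ^ 3"
      by (simp only: power_mult_distrib mult.assoc)
    moreover have "(r * (r\<^sup>2 - 1) - sqrt 2) / sqrt 2 = \<epsilon>"
      unfolding re by (simp add: algebra_simps)
    ultimately show ?thesis unfolding H F_def by simp
  qed
  show ?thesis
  proof (rule bigoI[of _ "K * sqrt 2 ^ 3"])
    have "\<forall>\<^sub>F \<epsilon> in at (0 :: real). \<bar>\<epsilon>\<bar> < e"
      unfolding eventually_at using e by (auto simp: dist_real_def)
    thus "\<forall>\<^sub>F \<epsilon> in at 0. norm (ln (H_e (alpha_star / (1 + \<epsilon>))) - (ln (sqrt 2 - 1) + \<epsilon>\<^sup>2 / (5 * sqrt 2)))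
        \<le> K * sqrt 2 ^ 3 * norm (\<epsilon> ^ 3)"
      by eventually_elim (use main in \<open>simp add: power_abs\<close>)
  qed
qed

theorem corollary7p3:
  fixes t :: real
  assumes "t > 0"
  shows
    "(\<exists>C0 \<epsilon>0 :: real. \<epsilon>0 > 0 \<and>
       (\<forall>n A b V \<epsilon> (m :: nat) q.
          hermitian_nsd n A \<and> b \<in> carrier_vec n \<and> b \<noteq> 0\<^sub>v n \<and>
          0 < \<epsilon> \<and> \<epsilon> < \<epsilon>0 \<and>
          int m \<ge> \<lceil>(ln (1 / \<epsilon>) - 1 / 2 * ln (ln (1 / \<epsilon>))) / arsinh 1 + C0\<rceil> \<and>
          q = real m / (sqrt 2 * t) \<and>
          si_basis A b q m V
          \<longrightarrow> si_error t A b V \<le> \<epsilon> * vec_norm2 b))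
     \<and>
     (\<forall>(\<alpha> :: real) (\<theta> :: real) m n A b V.
        \<alpha> > 0 \<and> \<theta> > 0 \<and> (\<lambda>N. real (m N) / real N) \<longlonglongrightarrow> \<theta> \<and>
        0 < \<alpha> / \<theta> \<and> \<alpha> / \<theta> < alpha_c \<and>
        si_sequence t \<alpha> m n A b V
        \<longrightarrow> si_root_limsup t m A b V \<le> ereal (H_e (\<alpha> / \<theta>)))
     \<and>
     H_e alpha_star = sqrt 2 - 1
     \<and>
     (\<forall>m n A b V.
        (\<lambda>N. real (m N) - real N) \<in> o(\<lambda>N. real N) \<and>
        si_sequence t alpha_star m n A b V
        \<longrightarrow> si_root_limsup t m A b V \<le> ereal (sqrt 2 - 1))
     \<and>
     (\<exists>\<delta> > 0. \<forall>\<epsilon> :: real. \<bar>\<epsilon>\<bar> < \<delta> \<longrightarrow>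
        (\<forall>m n A b V.
           (\<lambda>N. real (m N) / real N) \<longlonglongrightarrow> 1 + \<epsilon> \<and>
           si_sequence t alpha_star m n A b V
           \<longrightarrow> si_root_limsup t m A b V \<le> ereal (H_e (alpha_star / (1 + \<epsilon>)))))
     \<and>
     (\<lambda>\<epsilon> :: real. ln (H_e (alpha_star / (1 + \<epsilon>))) - (ln (sqrt 2 - 1) + \<epsilon>\<^sup>2 / (5 * sqrt 2)))
        \<in> O[at 0](\<lambda>\<epsilon>. \<epsilon> ^ 3)"
proof -
  have degree_rule: "\<exists>C0 \<epsilon>0 :: real. \<epsilon>0 > 0 \<and>
       (\<forall>n A b V \<epsilon> (m :: nat) q.
          hermitian_nsd n A \<and> b \<in> carrier_vec n \<and> b \<noteq> 0\<^sub>v n \<and>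
          0 < \<epsilon> \<and> \<epsilon> < \<epsilon>0 \<and>
          int m \<ge> \<lceil>(ln (1 / \<epsilon>) - 1 / 2 * ln (ln (1 / \<epsilon>))) / arsinh 1 + C0\<rceil> \<and>
          q = real m / (sqrt 2 * t) \<and>
          si_basis A b q m V
          \<longrightarrow> si_error t A b V \<le> \<epsilon> * vec_norm2 b)"
  proof -
    define C where "C = 8 / (sqrt 2 * sqrt (saddle_curvature (sqrt 2)))"
    have "C > 0" using saddle_curvature_pos[OF sqrt2_in_saddle_range] by (simp add: C_def)
    then obtain C0 where C0: "\<And>\<epsilon> m. 0 < \<epsilon> \<Longrightarrow> \<epsilon> < exp (-1) \<Longrightarrow>
      (ln (1 / \<epsilon>) - 1 / 2 * ln (ln (1 / \<epsilon>))) / arsinh 1 + C0 \<le> real m \<Longrightarrow>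
      m \<ge> 1 \<and> C / sqrt (real m) * (sqrt 2 - 1) ^ m \<le> \<epsilon>"
      using degree_rule_sufficient[of C] by blast
    show ?thesis
    proof (rule exI[of _ C0], rule exI[of _ "exp (-1)"], intro conjI allI impI; (elim conjE)?)
      fix n A b V \<epsilon> and m :: nat and q
      assume A: "hermitian_nsd n A" and b: "b \<in> carrier_vec n" and \<epsilon>: "0 < \<epsilon>" "\<epsilon> < exp (-1)"
        and m: "int m \<ge> \<lceil>(ln (1 / \<epsilon>) - 1 / 2 * ln (ln (1 / \<epsilon>))) / arsinh 1 + C0\<rceil>"
        and q: "q = real m / (sqrt 2 * t)" and V: "si_basis A b q m V"
      from m have "(ln (1 / \<epsilon>) - 1 / 2 * ln (ln (1 / \<epsilon>))) / arsinh 1 + C0 \<le> real m"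
        by (simp add: ceiling_le_iff)
      from C0[OF \<epsilon> this] have m1: "m \<ge> 1" and le: "C / sqrt (real m) * (sqrt 2 - 1) ^ m \<le> \<epsilon>"
        by auto
      have q': "q = real m / (t * (sqrt 2 * ((sqrt 2)\<^sup>2 - 1)))"
        by (simp add: q mult.commute)
      have "si_error t A b V \<le> C / sqrt (real m) * (sqrt 2 - 1) ^ m * vec_norm2 b"
        using si_error_bound[OF assms sqrt2_in_saddle_range m1 q' A b V]
        by (simp only: C_def saddle_rate_sqrt2)
      also have "\<dots> \<le> \<epsilon> * vec_norm2 b" by (intro mult_right_mono le vec_norm2_nonneg)
      finally show "si_error t A b V \<le> \<epsilon> * vec_norm2 b" .
    qed simp
  qed
  have perturbed: "si_root_limsup t m A b V \<le> ereal (H_e (alpha_star / (1 + \<epsilon>)))"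
    if "\<bar>\<epsilon>\<bar> < 1 / 4" "(\<lambda>N. real (m N) / real N) \<longlonglongrightarrow> 1 + \<epsilon>"
      "si_sequence t alpha_star m n A b V" for \<epsilon> m n A b V
  proof (rule si_root_limsup_le[OF assms _ _ that(2) _ that(3)])
    show "alpha_star > 0" by (simp add: alpha_star_def)
    show "1 + \<epsilon> > 0" using that(1) by linarith
    show "alpha_star / (1 + \<epsilon>) < alpha_c" by (rule alpha_star_less_alpha_c) (use that(1) in linarith)
  qed
  have unperturbed: "si_root_limsup t m A b V \<le> ereal (sqrt 2 - 1)"
    if "(\<lambda>N. real (m N) - real N) \<in> o(\<lambda>N. real N)" "si_sequence t alpha_star m n A b V"
    for m n A b V
  proof -
    have "(\<lambda>N. (real (m N) - real N) / real N + 1) \<longlonglongrightarrow> 0 + 1"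
      by (intro tendsto_add smalloD_tendsto[OF that(1)] tendsto_const)
    moreover have "\<forall>\<^sub>F N in sequentially. (real (m N) - real N) / real N + 1 = real (m N) / real N"
      using eventually_ge_at_top[of 1] by eventually_elim (simp add: field_simps)
    ultimately have "(\<lambda>N. real (m N) / real N) \<longlonglongrightarrow> 0 + 1"
      by (rule Lim_transform_eventually)
    hence "(\<lambda>N. real (m N) / real N) \<longlonglongrightarrow> 1 + 0" by simp
    from perturbed[OF _ this that(2)] show ?thesis by (simp add: H_e_alpha_star)
  qed
  show ?thesis
  proof (intro conjI)
    show "\<forall>(\<alpha> :: real) (\<theta> :: real) m n A b V.
        \<alpha> > 0 \<and> \<theta> > 0 \<and> (\<lambda>N. real (m N) / real N) \<longlonglongrightarrow> \<theta> \<and>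
        0 < \<alpha> / \<theta> \<and> \<alpha> / \<theta> < alpha_c \<and>
        si_sequence t \<alpha> m n A b V
        \<longrightarrow> si_root_limsup t m A b V \<le> ereal (H_e (\<alpha> / \<theta>))"
      using si_root_limsup_le[OF assms] by blast
    show "\<forall>m n A b V.
        (\<lambda>N. real (m N) - real N) \<in> o(\<lambda>N. real N) \<and>
        si_sequence t alpha_star m n A b V
        \<longrightarrow> si_root_limsup t m A b V \<le> ereal (sqrt 2 - 1)"
      using unperturbed by blast
    show "\<exists>\<delta> > 0. \<forall>\<epsilon> :: real. \<bar>\<epsilon>\<bar> < \<delta> \<longrightarrow>
        (\<forall>m n A b V.
           (\<lambda>N. real (m N) / real N) \<longlonglongrightarrow> 1 + \<epsilon> \<and>
           si_sequence t alpha_star m n A b V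
           \<longrightarrow> si_root_limsup t m A b V \<le> ereal (H_e (alpha_star / (1 + \<epsilon>))))"
      using perturbed by (intro exI[of _ "1 / 4"]) auto
  qed (rule degree_rule H_e_alpha_star ln_H_e_expansion)+
qed

end
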